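(* Let $n\ge 2$ and $d\ge 1$ be integers and let $m_1,\dots,m_n$ be nonzero real masses with $m_1+\dots+m_n\neq 0$. Let $\mathcal{I}_{n,d}$ be the space of all $G(d)$-invariant quadratic forms on the phase space $\mathbb{R}^{2nd}$ of the $n$-body problem in $\mathbb{R}^d$. Then, with the Poisson bracket as product, $\mathcal{I}_{n,d}$ is a Lie algebra isomorphic to $\mathfrak{sp}(2n-2)$ (the real symplectic Lie algebra of $(2n-2)\times(2n-2)$ Hamiltonian matrices). Moreover, the $G(d)$-invariant quadratic forms are given by the $2\times 2$ block-Laplacian matrices: a quadratic form $Q$ on $\mathbb{R}^{2nd}$ belongs to $\mathcal{I}_{n,d}$ if and only if $Q(Z)=\frac12 (Z,(\hat A\otimes \mathbf{1}_d)Z)$ for some symmetric $2n\times 2n$ matrix $\hat A$ that is $2\times2$ block-Laplacian.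
   Context: Phase space: $\mathbb{R}^{2nd}$ with coordinates $Z=(\mathbf{q}_1,\dots,\mathbf{q}_n,\mathbf{v}_1,\dots,\mathbf{v}_n)$, $\mathbf{q}_i,\mathbf{v}_i\in\mathbb{R}^d$ (positions and velocities $\mathbf{v}_i=\mathbf{p}_i/m_i$), with Poisson bracket determined by $\{(\mathbf{q}_i)_k,(\mathbf{v}_j)_l\}=\delta_{ij}\delta_{kl}/m_j$ and vanishing brackets among the components of the $\mathbf{q}$'s and among the components of the $\mathbf{v}$'s. $(\cdot,\cdot)$ is the Euclidean scalar product, $\mathbf{1}_d$ is the $d\times d$ identity matrix and $\otimes$ the Kronecker product; the ordering of variables is such that the $d$ components of each vector are consecutive entries of $Z$. A quadratic form is a homogeneous polynomial of degree 2 in the entries of $Z$. Symmetries: $G(d)$-invariance means invariance under all of the following transformations: translations $(\mathbf{q}_i,\mathbf{v}_i)\mapsto(\mathbf{q}_i+\mathbf{q}_0,\mathbf{v}_i)$, $\mathbf{q}_0\in\mathbb{R}^d$; boosts $(\mathbf{q}_i,\mathbf{v}_i)\mapsto(\mathbf{q}_i+t\mathbf{v}_0,\mathbf{v}_i+\mathbf{v}_0)$, $\mathbf{v}_0\in\mathbb{R}^d$, $t\in\mathbb{R}$; and rotations/reflections $(\mathbf{q}_i,\mathbf{v}_i)\mapsto(R\mathbf{q}_i,R\mathbf{v}_i)$, $R\in O(d)$ (each applied simultaneously to all $i=1,\dots,n$). Time translations are not included. A matrix is Laplacian if the vector $(1,\dots,1)^t$ lies in its kernel (all row sums are zero). A symmetric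 $2n\times 2n$ matrix is called $2\times 2$ block-Laplacian if each of its four $n\times n$ blocks is Laplacian; equivalently, its kernel contains both the vector $\mathbf{t}_1$ with first $n$ entries $1$ and last $n$ entries $0$, and the vector $\mathbf{t}_2$ with first $n$ entries $0$ and last $n$ entries $1$. *)

theory Defs
  imports "HOL-Analysis.Derivative" "HOL-Library.FuncSet" "Jordan_Normal_Form.VS_Connect"
begin

unbundle no vec_syntax

section \<open>Lie algebras\<close>

text \<open>As in the locale \<open>algebra\<close> of HOL-Algebra, the product of the algebra is the field
  \<open>mult\<close> of the module record; here it is the Lie bracket. The field \<open>one\<close> plays no role.\<close>

locale lie_algebra = R?: field R + L?: module R L for R (structure) and L (structure) +
  assumes bracket_closed:
      "\<lbrakk>x \<in> carrier L; y \<in> carrier L\<rbrakk> \<Longrightarrow> x \<otimes>\<^bsub>L\<^esub> y \<in> carrier L"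
    and bracket_add_left:
      "\<lbrakk>x \<in> carrier L; y \<in> carrier L; z \<in> carrier L\<rbrakk> \<Longrightarrow>
        (x \<oplus>\<^bsub>L\<^esub> y) \<otimes>\<^bsub>L\<^esub> z = x \<otimes>\<^bsub>L\<^esub> z \<oplus>\<^bsub>L\<^esub> y \<otimes>\<^bsub>L\<^esub> z"
    and bracket_add_right:
      "\<lbrakk>x \<in> carrier L; y \<in> carrier L; z \<in> carrier L\<rbrakk> \<Longrightarrow>
        x \<otimes>\<^bsub>L\<^esub> (y \<oplus>\<^bsub>L\<^esub> z) = x \<otimes>\<^bsub>L\<^esub> y \<oplus>\<^bsub>L\<^esub> x \<otimes>\<^bsub>L\<^esub> z"
    and bracket_smult_left:
      "\<lbrakk>a \<in> carrier R; x \<in> carrier L; y \<in> carrier L\<rbrakk> \<Longrightarrow>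
        (a \<odot>\<^bsub>L\<^esub> x) \<otimes>\<^bsub>L\<^esub> y = a \<odot>\<^bsub>L\<^esub> (x \<otimes>\<^bsub>L\<^esub> y)"
    and bracket_smult_right:
      "\<lbrakk>a \<in> carrier R; x \<in> carrier L; y \<in> carrier L\<rbrakk> \<Longrightarrow>
        x \<otimes>\<^bsub>L\<^esub> (a \<odot>\<^bsub>L\<^esub> y) = a \<odot>\<^bsub>L\<^esub> (x \<otimes>\<^bsub>L\<^esub> y)"
    and bracket_self:
      "x \<in> carrier L \<Longrightarrow> x \<otimes>\<^bsub>L\<^esub> x = \<zero>\<^bsub>L\<^esub>"
    and jacobi:
      "\<lbrakk>x \<in> carrier L; y \<in> carrier L; z \<in> carrier L\<rbrakk> \<Longrightarrow>
        x \<otimes>\<^bsub>L\<^esub> (y \<otimes>\<^bsub>L\<^esub> z) \<oplus>\<^bsub>L\<^esub> y \<otimes>\<^bsub>L\<^esub> (z \<otimes>\<^bsub>L\<^esub> x) \<oplus>\<^bsub>L\<^esub> z \<otimes>\<^bsub>L\<^esub> (x \<otimes>\<^bsub>L\<^esub> y)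
          = \<zero>\<^bsub>L\<^esub>"

definition lie_iso ::
  "('r, 'x) ring_scheme \<Rightarrow> ('r, 'a, 'y) module_scheme \<Rightarrow> ('r, 'b, 'z) module_scheme \<Rightarrow> ('a \<Rightarrow> 'b) set"
where
  "lie_iso R L M = {\<phi>. bij_betw \<phi> (carrier L) (carrier M) \<and>
     (\<forall>x\<in>carrier L. \<forall>y\<in>carrier L. \<phi> (x \<oplus>\<^bsub>L\<^esub> y) = \<phi> x \<oplus>\<^bsub>M\<^esub> \<phi> y) \<and>
     (\<forall>a\<in>carrier R. \<forall>x\<in>carrier L. \<phi> (a \<odot>\<^bsub>L\<^esub> x) = a \<odot>\<^bsub>M\<^esub> \<phi> x) \<and>
     (\<forall>x\<in>carrier L. \<forall>y\<in>carrier L. \<phi> (x \<otimes>\<^bsub>L\<^esub> y) = \<phi> x \<otimes>\<^bsub>M\<^esub> \<phi> y)}"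

definition lie_isomorphic ::
  "('r, 'x) ring_scheme \<Rightarrow> ('r, 'a, 'y) module_scheme \<Rightarrow> ('r, 'b, 'z) module_scheme \<Rightarrow> bool"
where
  "lie_isomorphic R L M \<longleftrightarrow> lie_iso R L M \<noteq> {}"

text \<open>\<open>sp N\<close> is the algebra of Hamiltonian matrices of size \<open>2N \<times> 2N\<close>.\<close>

definition symplectic_unit :: "nat \<Rightarrow> real mat" where
  "symplectic_unit N = four_block_mat (0\<^sub>m N N) (1\<^sub>m N) (- 1\<^sub>m N) (0\<^sub>m N N)"

definition hamiltonian_mats :: "nat \<Rightarrow> real mat set" where
  "hamiltonian_mats N = {X \<in> carrier_mat (2 * N) (2 * N).
     transpose_mat X * symplectic_unit N + symplectic_unit N * X = 0\<^sub>m (2 * N) (2 * N)}"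

definition sp :: "nat \<Rightarrow> (real, real mat) module" where
  "sp N = \<lparr>carrier = hamiltonian_mats N, mult = (\<lambda>X Y. X * Y - Y * X), one = undefined,
     zero = 0\<^sub>m (2 * N) (2 * N), add = (+), smult = (\<cdot>\<^sub>m)\<rparr>"

lemma symplectic_unit_carrier [simp]: "symplectic_unit N \<in> carrier_mat (2 * N) (2 * N)"
  unfolding symplectic_unit_def mult_2 by (intro four_block_carrier_mat) auto

section \<open>Phase space\<close>

text \<open>Bodies and components are numbered from 0. The entries of a phase space point are ordered
  body by body, all positions first.\<close>

abbreviation phase_space :: "nat \<Rightarrow> nat \<Rightarrow> real vec set" where
  "phase_space n d \<equiv> carrier_vec (2 * n * d)"

definition q_idx :: "nat \<Rightarrow> nat \<Rightarrow> nat \<Rightarrow> nat" where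
  "q_idx d i k = i * d + k"

definition v_idx :: "nat \<Rightarrow> nat \<Rightarrow> nat \<Rightarrow> nat \<Rightarrow> nat" where
  "v_idx n d i k = (n + i) * d + k"

definition pos :: "nat \<Rightarrow> real vec \<Rightarrow> nat \<Rightarrow> real vec" where
  "pos d Z i = vec d (\<lambda>k. Z $ q_idx d i k)"

definition vel :: "nat \<Rightarrow> nat \<Rightarrow> real vec \<Rightarrow> nat \<Rightarrow> real vec" where
  "vel n d Z i = vec d (\<lambda>k. Z $ v_idx n d i k)"

definition phase_point ::
  "nat \<Rightarrow> nat \<Rightarrow> (nat \<Rightarrow> real vec) \<Rightarrow> (nat \<Rightarrow> real vec) \<Rightarrow> real vec" where
  "phase_point n d q v = vec (2 * n * d) (\<lambda>a.
     if a < n * d then q (a div d) $ (a mod d) else v (a div d - n) $ (a mod d))"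

definition partial_deriv :: "(real vec \<Rightarrow> real) \<Rightarrow> nat \<Rightarrow> real vec \<Rightarrow> real" where
  "partial_deriv f a Z = deriv (\<lambda>t. f (Z + t \<cdot>\<^sub>v unit_vec (dim_vec Z) a)) 0"

text \<open>Functions on phase space are extensional, so that equality of functions on the
  phase space is equality in HOL.\<close>

definition poisson ::
  "nat \<Rightarrow> nat \<Rightarrow> (nat \<Rightarrow> real) \<Rightarrow> (real vec \<Rightarrow> real) \<Rightarrow> (real vec \<Rightarrow> real) \<Rightarrow> real vec \<Rightarrow> real" where
  "poisson n d m f g = (\<lambda>Z\<in>phase_space n d. \<Sum>j<n. \<Sum>k<d. 1 / m j *
     (partial_deriv f (q_idx d j k) Z * partial_deriv g (v_idx n d j k) Z -
      partial_deriv f (v_idx n d j k) Z * partial_deriv g (q_idx d j k) Z))"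

section \<open>Invariant quadratic forms\<close>

definition translate :: "nat \<Rightarrow> nat \<Rightarrow> real vec \<Rightarrow> real vec \<Rightarrow> real vec" where
  "translate n d q0 Z = phase_point n d (\<lambda>i. pos d Z i + q0) (vel n d Z)"

definition boost :: "nat \<Rightarrow> nat \<Rightarrow> real vec \<Rightarrow> real \<Rightarrow> real vec \<Rightarrow> real vec" where
  "boost n d v0 t Z =
     phase_point n d (\<lambda>i. pos d Z i + t \<cdot>\<^sub>v v0) (\<lambda>i. vel n d Z i + v0)"

definition rotate_phase :: "nat \<Rightarrow> nat \<Rightarrow> real mat \<Rightarrow> real vec \<Rightarrow> real vec" where
  "rotate_phase n d R Z =
     phase_point n d (\<lambda>i. R *\<^sub>v pos d Z i) (\<lambda>i. R *\<^sub>v vel n d Z i)"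

text \<open>The library predicate \<open>orthogonal_mat\<close> does not require normalised columns, so it does
  not describe \<open>O(d)\<close>.\<close>

definition orthogonal_group :: "nat \<Rightarrow> real mat set" where
  "orthogonal_group d = {R \<in> carrier_mat d d. transpose_mat R * R = 1\<^sub>m d}"

definition G_invariant :: "nat \<Rightarrow> nat \<Rightarrow> (real vec \<Rightarrow> real) \<Rightarrow> bool" where
  "G_invariant n d Q \<longleftrightarrow> (\<forall>Z\<in>phase_space n d.
     (\<forall>q0\<in>carrier_vec d. Q (translate n d q0 Z) = Q Z) \<and>
     (\<forall>v0\<in>carrier_vec d. \<forall>t. Q (boost n d v0 t Z) = Q Z) \<and>
     (\<forall>R\<in>orthogonal_group d. Q (rotate_phase n d R Z) = Q Z))"

definition quadratic_forms :: "nat \<Rightarrow> (real vec \<Rightarrow> real) set" where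
  "quadratic_forms N = {Q \<in> extensional (carrier_vec N).
     \<exists>c :: nat \<Rightarrow> nat \<Rightarrow> real.
       \<forall>Z\<in>carrier_vec N. Q Z = (\<Sum>a<N. \<Sum>b<N. c a b * (Z $ a * Z $ b))}"

definition invariant_forms :: "nat \<Rightarrow> nat \<Rightarrow> (real vec \<Rightarrow> real) set" where
  "invariant_forms n d = {Q \<in> quadratic_forms (2 * n * d). G_invariant n d Q}"

definition invariant_form_algebra ::
  "nat \<Rightarrow> nat \<Rightarrow> (nat \<Rightarrow> real) \<Rightarrow> (real, real vec \<Rightarrow> real) module" where
  "invariant_form_algebra n d m = \<lparr>carrier = invariant_forms n d,
     mult = poisson n d m, one = undefined,
     zero = (\<lambda>Z\<in>phase_space n d. 0),
     add = (\<lambda>f g. \<lambda>Z\<in>phase_space n d. f Z + g Z),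
     smult = (\<lambda>c f. \<lambda>Z\<in>phase_space n d. c * f Z)\<rparr>"

section \<open>Block-Laplacian matrices\<close>

definition laplacian :: "real mat \<Rightarrow> bool" where
  "laplacian A \<longleftrightarrow> A *\<^sub>v vec (dim_col A) (\<lambda>_. 1) = 0\<^sub>v (dim_row A)"

definition block_laplacian :: "nat \<Rightarrow> real mat \<Rightarrow> bool" where
  "block_laplacian n A \<longleftrightarrow>
     A \<in> carrier_mat (2 * n) (2 * n) \<and> transpose_mat A = A \<and>
     (case split_block A n n of (A1, A2, A3, A4) \<Rightarrow>
        laplacian A1 \<and> laplacian A2 \<and> laplacian A3 \<and> laplacian A4)"

definition kronecker :: "real mat \<Rightarrow> real mat \<Rightarrow> real mat" (infixl \<open>\<otimes>\<^sub>K\<close> 70) where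
  "A \<otimes>\<^sub>K B = mat (dim_row A * dim_row B) (dim_col A * dim_col B) (\<lambda>(i, j).
     A $$ (i div dim_row B, j div dim_col B) * B $$ (i mod dim_row B, j mod dim_col B))"

section \<open>Basic properties of the definitions\<close>

lemma symplectic_unit_dim [simp]:
  "dim_row (symplectic_unit N) = 2 * N" "dim_col (symplectic_unit N) = 2 * N"
  using symplectic_unit_carrier[of N] by (auto simp del: symplectic_unit_carrier)

lemma idx_bound:
  assumes "i < n" "k < d"
  shows "q_idx d i k < 2 * n * d" "v_idx n d i k < 2 * n * d"
proof -
  have "(n + i) * d + k < (n + i + 1) * d" using assms by simp
  also have "\<dots> \<le> (2 * n) * d" using assms by (intro mult_right_mono) auto
  finally show "v_idx n d i k < 2 * n * d" unfolding v_idx_def .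
  moreover have "q_idx d i k \<le> v_idx n d i k" by (simp add: q_idx_def v_idx_def)
  ultimately show "q_idx d i k < 2 * n * d" by simp
qed

lemma idx_eq_iff:
  assumes "i < n" "k < d" "j < n" "l < d"
  shows "q_idx d i k = q_idx d j l \<longleftrightarrow> i = j \<and> k = l"
    and "v_idx n d i k = v_idx n d j l \<longleftrightarrow> i = j \<and> k = l"
    and "q_idx d i k \<noteq> v_idx n d j l" "v_idx n d i k \<noteq> q_idx d j l"
proof -
  have *: "a * d + k = b * d + l \<longleftrightarrow> a = b \<and> k = l" if "k < d" "l < d" for a b k l
  proof
    assume eq: "a * d + k = b * d + l"
    have "a = (a * d + k) div d" "b = (b * d + l) div d" "k = (a * d + k) mod d"
      "l = (b * d + l) mod d" using that by auto
    then show "a = b \<and> k = l" using eq by metis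
  qed auto
  show "q_idx d i k = q_idx d j l \<longleftrightarrow> i = j \<and> k = l"
    "v_idx n d i k = v_idx n d j l \<longleftrightarrow> i = j \<and> k = l"
    "q_idx d i k \<noteq> v_idx n d j l" "v_idx n d i k \<noteq> q_idx d j l"
    using assms by (auto simp: q_idx_def v_idx_def *)
qed

lemma partial_deriv_coordinate:
  assumes "Z \<in> carrier_vec N" "a < N" "b < N"
  shows "partial_deriv (\<lambda>Z\<in>carrier_vec N. Z $ b) a Z = (if a = b then 1 else 0)"
proof -
  have "(\<lambda>t. (\<lambda>Z\<in>carrier_vec N. Z $ b) (Z + t \<cdot>\<^sub>v unit_vec (dim_vec Z) a)) =
      (\<lambda>t. Z $ b + t * (if a = b then 1 else 0))"
    using assms by (auto simp: fun_eq_iff)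
  moreover have "((\<lambda>t. Z $ b + t * (if a = b then 1 else 0)) has_real_derivative
      (if a = b then 1 else 0)) (at 0)"
    by (auto intro!: derivative_eq_intros)
  ultimately show ?thesis unfolding partial_deriv_def by (simp add: DERIV_imp_deriv)
qed

lemma poisson_coordinates:
  fixes n d :: nat
  defines "q \<equiv> \<lambda>i k. \<lambda>Z\<in>phase_space n d. Z $ q_idx d i k"
    and "v \<equiv> \<lambda>i k. \<lambda>Z\<in>phase_space n d. Z $ v_idx n d i k"
  assumes i: "i < n" "k < d" and j: "j < n" "l < d" and Z: "Z \<in> phase_space n d"
  shows "poisson n d m (q i k) (v j l) Z = (if i = j \<and> k = l then 1 / m j else 0)"
    and "poisson n d m (q i k) (q j l) Z = 0"
    and "poisson n d m (v i k) (v j l) Z = 0"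
proof -
  have "poisson n d m (q i k) (v j l) Z =
      (\<Sum>j'<n. \<Sum>k'<d. if j' = i \<and> k' = k \<and> i = j \<and> k = l then 1 / m j' else 0)"
    using i j Z unfolding poisson_def q_def v_def
    by (auto simp: partial_deriv_coordinate idx_bound idx_eq_iff intro!: sum.cong)
  also have "\<dots> = (\<Sum>j'<n. if j' = i then \<Sum>k'<d. if k' = k then (if i = j \<and> k = l then 1 / m i else 0) else 0 else 0)"
    by (intro sum.cong refl) (auto intro!: sum.cong)
  also have "\<dots> = (if i = j \<and> k = l then 1 / m j else 0)"
    using i by auto
  finally show "poisson n d m (q i k) (v j l) Z = (if i = j \<and> k = l then 1 / m j else 0)" .
  show "poisson n d m (q i k) (q j l) Z = 0"
    "poisson n d m (v i k) (v j l) Z = 0"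
    using i j Z unfolding poisson_def q_def v_def
    by (auto simp: partial_deriv_coordinate idx_bound idx_eq_iff intro!: sum.neutral)
qed

lemma phase_point_simps:
  assumes "\<And>i. i < n \<Longrightarrow> q i \<in> carrier_vec d" "\<And>i. i < n \<Longrightarrow> v i \<in> carrier_vec d" "i < n"
  shows "pos d (phase_point n d q v) i = q i" "vel n d (phase_point n d q v) i = v i"
proof -
  have "i * d + k < n * d" if "k < d" for k
    proof -
    have "i * d + k < (i + 1) * d" using that by simp
    also have "\<dots> \<le> n * d" using assms(3) by (intro mult_right_mono) auto
    finally show ?thesis .
  qed
  moreover have "(a * d + k) div d = a" "(a * d + k) mod d = k" if "k < d" for a k
    using that by auto
  moreover have "\<not> (n + i) * d + k < n * d" for k
    by (simp add: algebra_simps)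
  ultimately have "phase_point n d q v $ q_idx d i k = q i $ k"
    "phase_point n d q v $ v_idx n d i k = v i $ k" if "k < d" for k
    using that idx_bound[OF assms(3) that]
    by (auto simp: phase_point_def q_idx_def v_idx_def simp del: div_mult_self3 div_mult_self4)
  then show "pos d (phase_point n d q v) i = q i" "vel n d (phase_point n d q v) i = v i"
    using carrier_vecD[OF assms(1)[OF assms(3)]] carrier_vecD[OF assms(2)[OF assms(3)]]
    by (auto intro!: eq_vecI simp: pos_def vel_def)
qed

lemma hamiltonian_matsI:
  assumes "X \<in> carrier_mat (2 * N) (2 * N)"
    "transpose_mat X * symplectic_unit N = - (symplectic_unit N * X)"
  shows "X \<in> hamiltonian_mats N"
proof -
  have "symplectic_unit N * X \<in> carrier_mat (2 * N) (2 * N)"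
    using assms(1) by (auto intro: mult_carrier_mat[OF symplectic_unit_carrier])
  then show ?thesis unfolding hamiltonian_mats_def using assms
    by (auto simp: uminus_l_inv_mat)
qed

lemma hamiltonian_matsD:
  assumes "X \<in> hamiltonian_mats N"
  shows "X \<in> carrier_mat (2 * N) (2 * N)"
    "transpose_mat X * symplectic_unit N = - (symplectic_unit N * X)"
proof -
  show X: "X \<in> carrier_mat (2 * N) (2 * N)" using assms by (simp add: hamiltonian_mats_def)
  let ?A = "transpose_mat X * symplectic_unit N" and ?B = "symplectic_unit N * X"
  have c: "?A \<in> carrier_mat (2 * N) (2 * N)" "?B \<in> carrier_mat (2 * N) (2 * N)"
    using X by (auto intro: mult_carrier_mat[OF _ symplectic_unit_carrier] mult_carrier_mat[OF symplectic_unit_carrier])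
  have e: "?A + ?B = 0\<^sub>m (2 * N) (2 * N)" using assms by (simp add: hamiltonian_mats_def)
  show "?A = - ?B"
  proof (rule eq_matI)
    fix i j assume "i < dim_row (- ?B)" "j < dim_col (- ?B)"
    then have ij: "i < 2 * N" "j < 2 * N" using X symplectic_unit_carrier[of N] by (auto simp del: symplectic_unit_carrier)
    have "(?A + ?B) $$ (i, j) = 0" using e ij by simp
    moreover have "(?A + ?B) $$ (i, j) = ?A $$ (i,j) + ?B $$ (i,j)" using c ij by (intro index_add_mat) auto
    moreover have "(- ?B) $$ (i,j) = - (?B $$ (i,j))" using c ij by (intro index_uminus_mat) auto
    ultimately show "?A $$ (i, j) = (- ?B) $$ (i, j)" by linarith
  qed (use X in auto)
qed

lemma sp_lie_algebra: "lie_algebra class_ring (sp N)"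
proof -
  let ?J = "symplectic_unit N" let ?n = "2 * N"
  note J = symplectic_unit_carrier[of N]
  note c = hamiltonian_matsD(1)[of _ N]
  note dist = minus_mult_distrib_mat[where nr = ?n and n = ?n and nc = ?n]
    mult_minus_distrib_mat[where nr = ?n and n = ?n and nc = ?n]
    add_mult_distrib_mat[where nr = ?n and n = ?n and nc = ?n]
    mult_add_distrib_mat[where nr = ?n and n = ?n and nc = ?n]
    assoc_mult_mat[of _ ?n ?n _ ?n _ ?n] mult_smult_distrib[of _ ?n ?n _ ?n]
    mult_smult_assoc_mat[of _ ?n ?n _ ?n]
  have add: "X + Y \<in> hamiltonian_mats N" if h: "X \<in> hamiltonian_mats N" "Y \<in> hamiltonian_mats N" for X Y
  proof (rule hamiltonian_matsI)
    note cs = c[OF h(1)] c[OF h(2)] J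
    show "X + Y \<in> carrier_mat ?n ?n" using cs by auto
    have "transpose_mat (X + Y) * ?J = - (?J * X) + - (?J * Y)"
      using cs by (simp add: dist transpose_add[of _ ?n ?n] hamiltonian_matsD(2)[OF h(1)] hamiltonian_matsD(2)[OF h(2)])
    also have "\<dots> = - (?J * (X + Y))"
      using cs by (simp add: dist) (auto intro!: eq_matI simp del: index_mult_mat(1))
    finally show "transpose_mat (X + Y) * ?J = - (?J * (X + Y))" .
  qed
  have tsm: "transpose_mat (a \<cdot>\<^sub>m X) = a \<cdot>\<^sub>m transpose_mat X" for a and X :: "real mat"
    by (auto intro!: eq_matI)
  have smult: "a \<cdot>\<^sub>m X \<in> hamiltonian_mats N" if h: "X \<in> hamiltonian_mats N" for X a
  proof (rule hamiltonian_matsI)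
    note cs = c[OF h] J
    show "a \<cdot>\<^sub>m X \<in> carrier_mat ?n ?n" using cs by auto
    have "transpose_mat (a \<cdot>\<^sub>m X) * ?J = a \<cdot>\<^sub>m (transpose_mat X * ?J)"
      using cs by (simp add: dist tsm)
    also have "\<dots> = - (?J * (a \<cdot>\<^sub>m X))"
      using cs by (simp add: dist hamiltonian_matsD(2)[OF h]) (auto intro!: eq_matI simp del: index_mult_mat(1))
    finally show "transpose_mat (a \<cdot>\<^sub>m X) * ?J = - (?J * (a \<cdot>\<^sub>m X))" .
  qed
  have zero: "0\<^sub>m ?n ?n \<in> hamiltonian_mats N"
    using J by (auto simp: hamiltonian_mats_def)
  have key: "transpose_mat (X * Y) * ?J = ?J * (Y * X)"
    if "X \<in> hamiltonian_mats N" "Y \<in> hamiltonian_mats N" for X Y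
  proof -
    note cs = c[OF that(1)] c[OF that(2)] J
    have "transpose_mat (X * Y) * ?J = transpose_mat Y * (transpose_mat X * ?J)"
      using cs by (simp add: transpose_mult[of _ ?n ?n _ ?n] dist)
    also have "\<dots> = transpose_mat Y * (- (?J * X))" by (simp only: hamiltonian_matsD(2)[OF that(1)])
    also have "\<dots> = - ((transpose_mat Y * ?J) * X)" using cs by (simp add: dist)
    also have "\<dots> = ?J * (Y * X)" using cs by (simp add: hamiltonian_matsD(2)[OF that(2)] dist)
    finally show ?thesis .
  qed
  have bracket: "X * Y - Y * X \<in> hamiltonian_mats N"
    if "X \<in> hamiltonian_mats N" "Y \<in> hamiltonian_mats N" for X Y
  proof (rule hamiltonian_matsI)
    note cs = c[OF that(1)] c[OF that(2)] J
    have cc: "X * Y \<in> carrier_mat ?n ?n" "Y * X \<in> carrier_mat ?n ?n" using cs by auto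
    then show "X * Y - Y * X \<in> carrier_mat ?n ?n" by (intro minus_carrier_mat)
    have "transpose_mat (X * Y - Y * X) * ?J = transpose_mat (X * Y) * ?J - transpose_mat (Y * X) * ?J"
      using cc J by (simp add: transpose_minus[of _ ?n ?n] dist)
    also have "\<dots> = ?J * (Y * X) - ?J * (X * Y)" by (simp add: key that)
    also have "\<dots> = - (?J * (X * Y - Y * X))"
      using cc J carrier_matD[OF c[OF that(1)]] carrier_matD[OF c[OF that(2)]]
      by (simp add: dist) (auto intro!: eq_matI simp del: index_mult_mat(1))
    finally show "transpose_mat (X * Y - Y * X) * ?J = - (?J * (X * Y - Y * X))" .
  qed
  have neg: "- X \<in> hamiltonian_mats N" if "X \<in> hamiltonian_mats N" for X
  proof -
    have "- X = (-1) \<cdot>\<^sub>m X" by (auto intro!: eq_matI)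
    then show ?thesis using smult[OF that] by simp
  qed
  have ag: "abelian_group (sp N)"
  proof (rule abelian_groupI)
    fix x assume x: "x \<in> carrier (sp N)"
    show "\<exists>y\<in>carrier (sp N). y \<oplus>\<^bsub>sp N\<^esub> x = \<zero>\<^bsub>sp N\<^esub>"
      using x by (intro bexI[of _ "- x"]) (auto simp: sp_def neg dest!: c intro!: uminus_l_inv_mat)
  qed (auto simp: sp_def add zero dest!: c intro!: assoc_add_mat[of _ ?n ?n] comm_add_mat[of _ ?n ?n])
  have "cring (class_ring :: real ring)" "field (class_ring :: real ring)"
    by (intro class_cring.is_cring class_field.field_axioms)+
  moreover have "module class_ring (sp N)"
  proof (rule moduleI)
    show "cring (class_ring :: real ring)" by (rule class_cring.is_cring)
    show "abelian_group (sp N)" by (rule ag)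
  qed (auto simp: sp_def smult algebra_simps dest!: c intro!: eq_matI)
  moreover have "lie_algebra_axioms class_ring (sp N)"
  proof
    fix x y z and a :: real assume "x \<in> carrier (sp N)" "y \<in> carrier (sp N)" "z \<in> carrier (sp N)"
    then have h: "x \<in> hamiltonian_mats N" "y \<in> hamiltonian_mats N" "z \<in> hamiltonian_mats N"
      by (auto simp: sp_def)
    note cs = h[THEN c]
    have p: "A * B \<in> carrier_mat ?n ?n" "A - B \<in> carrier_mat ?n ?n" "A + B \<in> carrier_mat ?n ?n"
      if "A \<in> carrier_mat ?n ?n" "B \<in> carrier_mat ?n ?n" for A B :: "real mat"
      using that by (auto intro: minus_carrier_mat)
    show "x \<otimes>\<^bsub>sp N\<^esub> y \<in> carrier (sp N)" using h by (simp add: sp_def bracket)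
    show "(x \<oplus>\<^bsub>sp N\<^esub> y) \<otimes>\<^bsub>sp N\<^esub> z = x \<otimes>\<^bsub>sp N\<^esub> z \<oplus>\<^bsub>sp N\<^esub> y \<otimes>\<^bsub>sp N\<^esub> z"
      "x \<otimes>\<^bsub>sp N\<^esub> (y \<oplus>\<^bsub>sp N\<^esub> z) = x \<otimes>\<^bsub>sp N\<^esub> y \<oplus>\<^bsub>sp N\<^esub> x \<otimes>\<^bsub>sp N\<^esub> z"
      using cs by (simp_all add: sp_def dist p) (auto intro!: eq_matI simp del: index_mult_mat(1))
    show "(a \<odot>\<^bsub>sp N\<^esub> x) \<otimes>\<^bsub>sp N\<^esub> y = a \<odot>\<^bsub>sp N\<^esub> (x \<otimes>\<^bsub>sp N\<^esub> y)"
      "x \<otimes>\<^bsub>sp N\<^esub> (a \<odot>\<^bsub>sp N\<^esub> y) = a \<odot>\<^bsub>sp N\<^esub> (x \<otimes>\<^bsub>sp N\<^esub> y)"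
      using cs by (simp_all add: sp_def dist p) (auto intro!: eq_matI simp del: index_mult_mat(1) simp: algebra_simps)
    show "x \<otimes>\<^bsub>sp N\<^esub> x = \<zero>\<^bsub>sp N\<^esub>" using cs by (auto simp: sp_def)
    show "x \<otimes>\<^bsub>sp N\<^esub> (y \<otimes>\<^bsub>sp N\<^esub> z) \<oplus>\<^bsub>sp N\<^esub> y \<otimes>\<^bsub>sp N\<^esub> (z \<otimes>\<^bsub>sp N\<^esub> x) \<oplus>\<^bsub>sp N\<^esub> z \<otimes>\<^bsub>sp N\<^esub> (x \<otimes>\<^bsub>sp N\<^esub> y) = \<zero>\<^bsub>sp N\<^esub>"
      using cs by (simp add: sp_def dist p) (auto intro!: eq_matI simp del: index_mult_mat(1))
  qed
  ultimately show ?thesis by (simp add: lie_algebra_def)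
qed

end

theory Submission
  imports Defs
begin

text \<open>Reflections and coordinate permutations force an invariant form to be
  \<open>1/2 (Z, (A \<otimes> 1) Z)\<close>, and invariance under translations and boosts then puts the two
  block vectors of ones into the kernel of \<open>A\<close>. Under this description the Poisson bracket becomes
  \<open>A P B - B P A\<close>, where \<open>P\<close> is the matrix of the Poisson structure. Block-Laplacian
  matrices are exactly the congruences \<open>U\<^sup>T S U\<close> of symmetric matrices \<open>S\<close> of size
  \<open>2n - 2\<close>, where \<open>U\<close> passes to relative positions and velocities. With a basis of
  differences for one and the dual basis for the other, \<open>U P U\<^sup>T = J\<close>; the dual basis exists
  because the total mass is nonzero. Hence \<open>X \<mapsto> U\<^sup>T (-J X) U\<close> is a
  Lie algebra isomorphism from the Hamiltonian matrices, and the Lie algebra axioms for the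
  invariant forms are transported along it.\<close>

text \<open>The linear functionals of one slice that vanish on both block vectors of ones form a
  space of dimension 2n - 2, and the block-Laplacian forms are the quadratic expressions in them.
  Brackets of such functionals are constants, so everything rests on this constant pairing being
  nondegenerate: the quadratic forms over a symplectic space make up its symplectic Lie algebra. A
  position functional with coefficients a_i and a velocity functional with coefficients b_i have the
  bracket sum of a_i b_i / m_i. For this diagonal pairing, the complement of the zero-sum
  coefficient vectors is spanned by the mass vector, which itself has sum zero exactly when the
  total mass vanishes. This is where the total mass enters. Since the masses may have both signs, an
  orthonormal basis need not exist; a basis and its dual are written down explicitly
  instead.\<close>

section \<open>Slices of phase space points\<close>

text \<open>The \<open>k\<close>-th slice collects the \<open>k\<close>-th components of all positions and velocities, so that
  \<open>A \<otimes>\<^sub>K 1\<^sub>m d\<close> acts on each slice separately as \<open>A\<close>.\<close>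

definition slice :: "nat \<Rightarrow> nat \<Rightarrow> nat \<Rightarrow> real vec \<Rightarrow> real vec" where
  "slice N d k Z = vec N (\<lambda>a. Z $ (a * d + k))"

text \<open>Test points for reading off \<open>A\<close>: on a point supported in one slice, the
  form of \<open>A \<otimes>\<^sub>K 1\<^sub>m d\<close> reduces to the form of \<open>A\<close>
  itself.\<close>

definition embed_slice :: "nat \<Rightarrow> nat \<Rightarrow> nat \<Rightarrow> real vec \<Rightarrow> real vec" where
  "embed_slice N d k x = vec (N * d) (\<lambda>i. if i mod d = k then x $ (i div d) else 0)"

lemma slice_carrier [simp]: "slice N d k Z \<in> carrier_vec N"
  by (simp add: slice_def)

lemma slice_dim [simp]: "dim_vec (slice N d k Z) = N"
  by (simp add: slice_def)

lemma embed_slice_carrier [simp]: "embed_slice N d k x \<in> carrier_vec (N * d)"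
  by (simp add: embed_slice_def)

lemma pair_index_less:
  assumes "a < N" "k < (d::nat)"
  shows "a * d + k < N * d"
proof -
  have "a * d + k < (a + 1) * d" using assms by simp
  also have "\<dots> \<le> N * d" using assms by (intro mult_right_mono) auto
  finally show ?thesis .
qed

lemma slice_embed_slice:
  assumes "x \<in> carrier_vec N" "l < d"
  shows "slice N d l (embed_slice N d k x) = (if l = k then x else 0\<^sub>v N)"
  using assms by (auto simp: slice_def embed_slice_def pair_index_less intro!: eq_vecI)

lemma sum_pair_index:
  fixes f :: "nat \<Rightarrow> real"
  shows "(\<Sum>i<N * d. f i) = (\<Sum>k<d. \<Sum>a<N. f (a * d + k))"
proof -
  have "(\<Sum>i<N * d. f i) = (\<Sum>a<N. sum f {a * d..<a * d + d})"
    by (rule sum.nat_group[symmetric])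
  also have "\<dots> = (\<Sum>a<N. \<Sum>k<d. f (a * d + k))"
  proof (rule sum.cong[OF refl])
    fix a
    show "sum f {a * d..<a * d + d} = (\<Sum>k<d. f (a * d + k))"
      by (rule sum.reindex_bij_witness[of _ "\<lambda>k. a * d + k" "\<lambda>i. i - a * d"]) auto
  qed
  finally show ?thesis by (simp add: sum.swap[of _ "{..<N}"])
qed

lemma scalar_prod_slices:
  assumes "Z \<in> carrier_vec (N * d)" "Y \<in> carrier_vec (N * d)"
  shows "Z \<bullet> Y = (\<Sum>k<d. slice N d k Z \<bullet> slice N d k Y)"
  using assms by (auto simp: scalar_prod_def atLeast0LessThan sum_pair_index slice_def)

lemma kronecker_one_carrier [simp]:
  assumes "A \<in> carrier_mat N N"
  shows "A \<otimes>\<^sub>K 1\<^sub>m d \<in> carrier_mat (N * d) (N * d)"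
  using assms by (simp add: kronecker_def)

lemma slice_kronecker_one:
  assumes "A \<in> carrier_mat N N" "Z \<in> carrier_vec (N * d)" "k < d"
  shows "slice N d k ((A \<otimes>\<^sub>K 1\<^sub>m d) *\<^sub>v Z) = A *\<^sub>v slice N d k Z"
proof (rule eq_vecI)
  fix a assume "a < dim_vec (A *\<^sub>v slice N d k Z)"
  then have a: "a < N" using assms by simp
  have "slice N d k ((A \<otimes>\<^sub>K 1\<^sub>m d) *\<^sub>v Z) $ a =
      (\<Sum>l<d. \<Sum>b<N. (A $$ (a, b) * (if k = l then 1 else 0)) * Z $ (b * d + l))"
    using assms a
    by (simp add: slice_def pair_index_less kronecker_def scalar_prod_def atLeast0LessThan
        sum_pair_index)
  also have "\<dots> = (\<Sum>l<d. if k = l then \<Sum>b<N. A $$ (a, b) * Z $ (b * d + k) else 0)"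
    by (intro sum.cong) auto
  also have "\<dots> = (A *\<^sub>v slice N d k Z) $ a"
    using assms a by (simp add: slice_def scalar_prod_def atLeast0LessThan)
  finally show "slice N d k ((A \<otimes>\<^sub>K 1\<^sub>m d) *\<^sub>v Z) $ a = (A *\<^sub>v slice N d k Z) $ a" .
qed (use assms in simp)

text \<open>Restricted to the phase space because members of \<open>quadratic_forms\<close> are
  extensional, so that forms can be compared as functions.\<close>

definition kronecker_form :: "nat \<Rightarrow> real mat \<Rightarrow> real vec \<Rightarrow> real" where
  "kronecker_form d A = (\<lambda>Z\<in>carrier_vec (dim_col A * d). 1 / 2 * (Z \<bullet> ((A \<otimes>\<^sub>K 1\<^sub>m d) *\<^sub>v Z)))"

lemma kronecker_form_slices:
  assumes "A \<in> carrier_mat N N" "Z \<in> carrier_vec (N * d)"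
  shows "kronecker_form d A Z = 1 / 2 * (\<Sum>k<d. slice N d k Z \<bullet> (A *\<^sub>v slice N d k Z))"
  using assms
  by (simp add: kronecker_form_def scalar_prod_slices[of _ N d] mult_mat_vec_carrier[of _ "N * d" "N * d"]
      slice_kronecker_one)

text \<open>Phrased through the slices of \<open>Z\<close> so that it covers not only embedded
  slices but also their translates and boosts.\<close>

lemma kronecker_form_single_slice:
  assumes "A \<in> carrier_mat N N" "x \<in> carrier_vec N" "k < d" "Z \<in> carrier_vec (N * d)"
    and "\<And>l. l < d \<Longrightarrow> slice N d l Z = (if l = k then x else 0\<^sub>v N)"
  shows "kronecker_form d A Z = 1 / 2 * (x \<bullet> (A *\<^sub>v x))"
proof -
  have "(\<Sum>l<d. slice N d l Z \<bullet> (A *\<^sub>v slice N d l Z)) =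
      (\<Sum>l<d. if l = k then x \<bullet> (A *\<^sub>v x) else 0)"
    using assms mult_mat_vec_carrier[of A N N "0\<^sub>v N"]
    by (intro sum.cong) auto
  then show ?thesis
    using assms by (simp add: kronecker_form_slices[OF assms(1,4)])
qed

lemma kronecker_form_embed_slice:
  assumes "A \<in> carrier_mat N N" "x \<in> carrier_vec N" "k < d"
  shows "kronecker_form d A (embed_slice N d k x) = 1 / 2 * (x \<bullet> (A *\<^sub>v x))"
  using assms by (intro kronecker_form_single_slice[where k = k]) (auto simp: slice_embed_slice)

section \<open>Polarisation and uniqueness of the symmetric matrix of a form\<close>

lemma symmetric_scalar_prod:
  fixes A :: "real mat"
  assumes "A \<in> carrier_mat N N" "transpose_mat A = A" "x \<in> carrier_vec N" "y \<in> carrier_vec N"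
  shows "x \<bullet> (A *\<^sub>v y) = y \<bullet> (A *\<^sub>v x)"
proof -
  have "y \<bullet> (A *\<^sub>v x) = (A *\<^sub>v x) \<bullet> y"
    using assms by (intro comm_scalar_prod) auto
  also have "\<dots> = x \<bullet> (transpose_mat A *\<^sub>v y)"
    using assms transpose_vec_mult_scalar[of A N N x y]
    by (metis (no_types, lifting) comm_scalar_prod mult_mat_vec_carrier)
  finally show ?thesis using assms by simp
qed

lemma quadratic_form_add:
  fixes A :: "real mat"
  assumes "A \<in> carrier_mat N N" "transpose_mat A = A" "x \<in> carrier_vec N" "y \<in> carrier_vec N"
  shows "(x + y) \<bullet> (A *\<^sub>v (x + y)) = x \<bullet> (A *\<^sub>v x) + 2 * (x \<bullet> (A *\<^sub>v y)) + y \<bullet> (A *\<^sub>v y)"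
proof -
  have c: "A *\<^sub>v x \<in> carrier_vec N" "A *\<^sub>v y \<in> carrier_vec N" using assms by auto
  show ?thesis
    using assms c symmetric_scalar_prod[OF assms]
    by (simp add: mult_add_distrib_mat_vec[OF assms(1,3,4)] add_scalar_prod_distrib[of _ N]
        scalar_prod_add_distrib[of _ N])
qed

text \<open>Polarisation: the values on two unit vectors and on their sum determine the
  corresponding entry.\<close>

lemma symmetric_form_inj:
  fixes A B :: "real mat"
  assumes A: "A \<in> carrier_mat N N" "transpose_mat A = A"
    and B: "B \<in> carrier_mat N N" "transpose_mat B = B"
    and eq: "\<And>x. x \<in> carrier_vec N \<Longrightarrow> x \<bullet> (A *\<^sub>v x) = x \<bullet> (B *\<^sub>v x)"
  shows "A = B"
proof (rule eq_matI)
  fix i j assume "i < dim_row B" "j < dim_col B"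
  then have ij: "i < N" "j < N" using B by auto
  have *: "unit_vec N i \<bullet> (C *\<^sub>v unit_vec N j) = C $$ (i, j)" if "C \<in> carrier_mat N N" for C :: "real mat"
    using that ij by (simp add: scalar_prod_left_unit[of _ N] mult_mat_vec_def)
  let ?x = "unit_vec N i :: real vec" and ?y = "unit_vec N j :: real vec"
  have "?x \<bullet> (A *\<^sub>v ?y) = ?x \<bullet> (B *\<^sub>v ?y)"
    using quadratic_form_add[OF A, of ?x ?y] quadratic_form_add[OF B, of ?x ?y]
      eq[of "?x + ?y"] eq[of ?x] eq[of ?y]
    by simp
  then show "A $$ (i, j) = B $$ (i, j)" using A B by (simp add: *)
qed (use A B in auto)

lemma kronecker_form_inj:
  assumes A: "A \<in> carrier_mat N N" "transpose_mat A = A"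
    and B: "B \<in> carrier_mat N N" "transpose_mat B = B"
    and "d \<ge> 1" and eq: "kronecker_form d A = kronecker_form d B"
  shows "A = B"
proof (rule symmetric_form_inj[OF A B])
  fix x :: "real vec" assume "x \<in> carrier_vec N"
  then show "x \<bullet> (A *\<^sub>v x) = x \<bullet> (B *\<^sub>v x)"
    using kronecker_form_embed_slice[of A N x 0 d] kronecker_form_embed_slice[of B N x 0 d] A B eq
      \<open>d \<ge> 1\<close> by simp
qed

lemma kronecker_form_quadratic:
  assumes "A \<in> carrier_mat N N"
  shows "kronecker_form d A \<in> quadratic_forms (N * d)"
proof -
  have "kronecker_form d A Z = (\<Sum>a<N * d. \<Sum>b<N * d. (1 / 2 * (A \<otimes>\<^sub>K 1\<^sub>m d) $$ (a, b)) * (Z $ a * Z $ b))"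
    if "Z \<in> carrier_vec (N * d)" for Z
  proof -
    have "dim_row (A \<otimes>\<^sub>K 1\<^sub>m d) = N * d" "dim_col (A \<otimes>\<^sub>K 1\<^sub>m d) = N * d"
      using kronecker_one_carrier[OF assms, of d] by blast+
    then show ?thesis using that assms
      by (auto simp: kronecker_form_def scalar_prod_def atLeast0LessThan sum_distrib_left
          intro!: sum.cong)
  qed
  then show ?thesis using assms
    unfolding quadratic_forms_def
    by (auto simp: kronecker_form_def simp del: times_divide_eq_left mult_1 intro!: exI[of _ "\<lambda>a b. 1 / 2 * (A \<otimes>\<^sub>K 1\<^sub>m d) $$ (a, b)"])
qed

section \<open>The Poisson bracket of two Kronecker forms\<close>

definition inv_mass_mat :: "nat \<Rightarrow> (nat \<Rightarrow> real) \<Rightarrow> real mat" where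
  "inv_mass_mat n m = mat n n (\<lambda>(i, j). if i = j then 1 / m i else 0)"

text \<open>Its entries are the mutual brackets of the 2n coordinates of a single slice, which
  depend on the masses but not on \<open>d\<close>.\<close>

definition poisson_mat :: "nat \<Rightarrow> (nat \<Rightarrow> real) \<Rightarrow> real mat" where
  "poisson_mat n m = four_block_mat (0\<^sub>m n n) (inv_mass_mat n m)
     (- inv_mass_mat n m) (0\<^sub>m n n)"

lemma inv_mass_mat_carrier [simp]: "inv_mass_mat n m \<in> carrier_mat n n"
  by (simp add: inv_mass_mat_def)

lemma poisson_mat_carrier [simp]: "poisson_mat n m \<in> carrier_mat (2 * n) (2 * n)"
  unfolding poisson_mat_def mult_2 by (intro four_block_carrier_mat) auto

lemma mult_poisson_mat_vec:
  assumes y: "y \<in> carrier_vec (2 * n)" and i: "i < n"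
  shows "(poisson_mat n m *\<^sub>v y) $ i = 1 / m i * y $ (n + i)"
    and "(poisson_mat n m *\<^sub>v y) $ (n + i) = - (1 / m i * y $ i)"
proof -
  note P = poisson_mat_carrier[of n m]
  have row: "(poisson_mat n m *\<^sub>v y) $ a = (\<Sum>j<2 * n. poisson_mat n m $$ (a, j) * y $ j)"
    if "a < 2 * n" for a
    using that y carrier_matD[OF P] by (simp add: scalar_prod_def atLeast0LessThan)
  have "(poisson_mat n m *\<^sub>v y) $ i = (\<Sum>j<2 * n. if j = n + i then 1 / m i * y $ j else 0)"
    using i by (subst row, simp, intro sum.cong refl) (auto simp: poisson_mat_def inv_mass_mat_def)
  then show "(poisson_mat n m *\<^sub>v y) $ i = 1 / m i * y $ (n + i)"
    using i by simp
  have "(poisson_mat n m *\<^sub>v y) $ (n + i) = (\<Sum>j<2 * n. if j = i then - (1 / m i * y $ j) else 0)"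
    using i by (subst row, simp, intro sum.cong refl) (auto simp: poisson_mat_def inv_mass_mat_def)
  then show "(poisson_mat n m *\<^sub>v y) $ (n + i) = - (1 / m i * y $ i)"
    using i by simp
qed

lemma sum_double:
  fixes f :: "nat \<Rightarrow> real"
  shows "(\<Sum>i<2 * n. f i) = (\<Sum>i<n. f i + f (n + i))"
proof -
  have "(\<Sum>i<2 * n. f i) = (\<Sum>i<n. f i) + (\<Sum>i=n..<2 * n. f i)"
    using sum.atLeastLessThan_concat[of 0 n "2 * n" f] by (simp add: lessThan_atLeast0)
  also have "(\<Sum>i=n..<2 * n. f i) = (\<Sum>i<n. f (n + i))"
    by (rule sum.reindex_bij_witness[of _ "\<lambda>i. n + i" "\<lambda>i. i - n"]) auto
  finally show ?thesis by (simp add: sum.distrib)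
qed

lemma scalar_prod_poisson_mat:
  assumes "x \<in> carrier_vec (2 * n)" "y \<in> carrier_vec (2 * n)"
  shows "x \<bullet> (poisson_mat n m *\<^sub>v y) =
    (\<Sum>i<n. 1 / m i * (x $ i * y $ (n + i) - x $ (n + i) * y $ i))"
proof -
  have "x \<bullet> (poisson_mat n m *\<^sub>v y) = (\<Sum>i<2 * n. x $ i * (poisson_mat n m *\<^sub>v y) $ i)"
    using carrier_matD[OF poisson_mat_carrier[of n m]]
    by (simp add: scalar_prod_def atLeast0LessThan)
  also have "\<dots> = (\<Sum>i<n. 1 / m i * (x $ i * y $ (n + i) - x $ (n + i) * y $ i))"
    unfolding sum_double using assms
    by (intro sum.cong) (auto simp: mult_poisson_mat_vec right_diff_distrib)
  finally show ?thesis .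
qed

lemma transpose_kronecker_one:
  assumes "A \<in> carrier_mat N N" "transpose_mat A = A"
  shows "transpose_mat (A \<otimes>\<^sub>K 1\<^sub>m d) = A \<otimes>\<^sub>K 1\<^sub>m d"
proof (rule eq_matI)
  fix i j assume "i < dim_row (A \<otimes>\<^sub>K 1\<^sub>m d)" "j < dim_col (A \<otimes>\<^sub>K 1\<^sub>m d)"
  then have ij: "i < N * d" "j < N * d" using assms by (auto simp: kronecker_def)
  then have "d > 0" by (cases d) auto
  then have b: "i div d < N" "j div d < N" "i mod d < d" "j mod d < d"
    using ij by (auto simp: less_mult_imp_div_less)
  have "A $$ (i div d, j div d) = A $$ (j div d, i div d)"
    using assms b by (metis carrier_matD index_transpose_mat(1))
  then show "transpose_mat (A \<otimes>\<^sub>K 1\<^sub>m d) $$ (i, j) = (A \<otimes>\<^sub>K 1\<^sub>m d) $$ (i, j)"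
    using assms ij b by (auto simp: kronecker_def)
qed (use assms in \<open>auto simp: kronecker_def\<close>)

text \<open>Along a coordinate line the form is a polynomial of degree 2 in t. Symmetry of
  \<open>B\<close> makes its two mixed terms equal, which cancels the factor 1/2 in the linear
  coefficient.\<close>

lemma partial_deriv_quadratic_form:
  assumes B: "B \<in> carrier_mat N N" "transpose_mat B = B" and Z: "Z \<in> carrier_vec N" and a: "a < N"
  shows "partial_deriv (\<lambda>Z\<in>carrier_vec N. 1 / 2 * (Z \<bullet> (B *\<^sub>v Z))) a Z = (B *\<^sub>v Z) $ a"
proof -
  let ?u = "unit_vec N a :: real vec"
  have BZ: "B *\<^sub>v Z \<in> carrier_vec N" "B *\<^sub>v ?u \<in> carrier_vec N" using B Z by auto
  have "(Z + t \<cdot>\<^sub>v ?u) \<bullet> (B *\<^sub>v (Z + t \<cdot>\<^sub>v ?u)) =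
      Z \<bullet> (B *\<^sub>v Z) + 2 * t * (B *\<^sub>v Z) $ a + t\<^sup>2 * (B *\<^sub>v ?u) $ a" for t
  proof -
    have "Z \<bullet> (B *\<^sub>v ?u) = (B *\<^sub>v Z) $ a"
      using symmetric_scalar_prod[OF B Z, of ?u] BZ a by (simp add: scalar_prod_left_unit[of _ N])
    then show ?thesis
      using B Z BZ a
      by (simp add: quadratic_form_add[OF B] mult_mat_vec[of _ N N] scalar_prod_left_unit[of _ N]
          power2_eq_square)
  qed
  then have "(\<lambda>t. (\<lambda>Z\<in>carrier_vec N. 1 / 2 * (Z \<bullet> (B *\<^sub>v Z))) (Z + t \<cdot>\<^sub>v unit_vec (dim_vec Z) a)) =
      (\<lambda>t. 1 / 2 * (Z \<bullet> (B *\<^sub>v Z) + 2 * t * (B *\<^sub>v Z) $ a + t\<^sup>2 * (B *\<^sub>v ?u) $ a))"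
    using Z by (auto simp: fun_eq_iff)
  moreover have "((\<lambda>t. 1 / 2 * (Z \<bullet> (B *\<^sub>v Z) + 2 * t * (B *\<^sub>v Z) $ a + t\<^sup>2 * (B *\<^sub>v ?u) $ a))
      has_real_derivative (B *\<^sub>v Z) $ a) (at 0)"
    by (auto intro!: derivative_eq_intros)
  ultimately show ?thesis unfolding partial_deriv_def by (simp add: DERIV_imp_deriv)
qed

lemma partial_deriv_kronecker_form:
  assumes A: "A \<in> carrier_mat N N" "transpose_mat A = A" and Z: "Z \<in> carrier_vec (N * d)"
    and "a < N" "k < d"
  shows "partial_deriv (kronecker_form d A) (a * d + k) Z = (A *\<^sub>v slice N d k Z) $ a"
proof -
  have "partial_deriv (kronecker_form d A) (a * d + k) Z = ((A \<otimes>\<^sub>K 1\<^sub>m d) *\<^sub>v Z) $ (a * d + k)"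
    using partial_deriv_quadratic_form[OF kronecker_one_carrier[OF A(1)] transpose_kronecker_one[OF A] Z]
      A assms by (simp add: kronecker_form_def pair_index_less)
  also have "\<dots> = slice N d k ((A \<otimes>\<^sub>K 1\<^sub>m d) *\<^sub>v Z) $ a"
    using assms by (simp add: slice_def)
  finally show ?thesis using assms by (simp add: slice_kronecker_one)
qed

text \<open>The bracket is the form of \<open>2 A P B\<close> with \<open>P\<close> the Poisson matrix; the matrix below is its
  symmetrisation.\<close>

lemma poisson_kronecker_form:
  assumes A: "A \<in> carrier_mat (2 * n) (2 * n)" "transpose_mat A = A"
    and B: "B \<in> carrier_mat (2 * n) (2 * n)" "transpose_mat B = B"
  shows "poisson n d m (kronecker_form d A) (kronecker_form d B) =
    kronecker_form d (A * poisson_mat n m * B - B * poisson_mat n m * A)"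
proof
  fix Z
  let ?P = "poisson_mat n m"
  let ?N = "2 * n"
  let ?C = "A * ?P * B - B * ?P * A"
  note P = poisson_mat_carrier[of n m]
  have c: "A * ?P * B \<in> carrier_mat ?N ?N" "B * ?P * A \<in> carrier_mat ?N ?N"
    using A B P by (auto intro!: mult_carrier_mat)
  have C: "?C \<in> carrier_mat ?N ?N" using c by (intro minus_carrier_mat)
  show "poisson n d m (kronecker_form d A) (kronecker_form d B) Z = kronecker_form d ?C Z"
  proof (cases "Z \<in> phase_space n d")
    case False
    then show ?thesis using carrier_matD(2)[OF C] by (simp only: poisson_def kronecker_form_def) simp
  next
    case Z: True
    have form: "1 / 2 * (z \<bullet> (?C *\<^sub>v z)) = (A *\<^sub>v z) \<bullet> (?P *\<^sub>v (B *\<^sub>v z))"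
      if z: "z \<in> carrier_vec ?N" for z
    proof -
      have mv: "M *\<^sub>v z \<in> carrier_vec ?N" if "M \<in> carrier_mat ?N ?N" "z \<in> carrier_vec ?N"
        for M :: "real mat" and z using that by auto
      have assoc: "z \<bullet> ((X * ?P * Y) *\<^sub>v z) = (X *\<^sub>v z) \<bullet> (?P *\<^sub>v (Y *\<^sub>v z))"
        if X: "X \<in> carrier_mat ?N ?N" "transpose_mat X = X" and Y: "Y \<in> carrier_mat ?N ?N" for X Y
      proof -
        have "(X * ?P * Y) *\<^sub>v z = X *\<^sub>v (?P *\<^sub>v (Y *\<^sub>v z))"
          using X Y P z
          by (simp add: assoc_mult_mat_vec[of _ ?N ?N _ ?N] mult_carrier_mat[OF X(1) P] mv)
        moreover have "z \<bullet> (X *\<^sub>v (?P *\<^sub>v (Y *\<^sub>v z))) = (?P *\<^sub>v (Y *\<^sub>v z)) \<bullet> (X *\<^sub>v z)"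
          by (intro symmetric_scalar_prod[OF X] mult_mat_vec_carrier[of _ ?N ?N] P Y z)
        moreover have "\<dots> = (X *\<^sub>v z) \<bullet> (?P *\<^sub>v (Y *\<^sub>v z))"
          by (intro comm_scalar_prod[of _ ?N] mult_mat_vec_carrier[of _ ?N ?N] X(1) P Y z)
        ultimately show ?thesis by simp
      qed
      \<comment> \<open>The Poisson matrix is antisymmetric, so the two products in
        \<open>?C\<close> contribute equally to the form; this doubling cancels the factor
        1/2.\<close>
      have anti: "(B *\<^sub>v z) \<bullet> (?P *\<^sub>v (A *\<^sub>v z)) = - ((A *\<^sub>v z) \<bullet> (?P *\<^sub>v (B *\<^sub>v z)))"
        using A B z mv
        by (simp add: scalar_prod_poisson_mat sum_negf[symmetric] algebra_simps)
      have "z \<bullet> (?C *\<^sub>v z) = z \<bullet> ((A * ?P * B) *\<^sub>v z) - z \<bullet> ((B * ?P * A) *\<^sub>v z)"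
        using c z mv by (simp add: minus_mult_distrib_mat_vec[OF c z] scalar_prod_minus_distrib[of _ ?N])
      then show ?thesis using A B by (simp add: assoc anti)
    qed
    \<comment> \<open>The gradient of a Kronecker form acts slice by slice, so the bracket is a sum
      of \<open>d\<close> brackets of one-dimensional problems.\<close>
    have "poisson n d m (kronecker_form d A) (kronecker_form d B) Z =
        (\<Sum>k<d. \<Sum>j<n. 1 / m j *
          ((A *\<^sub>v slice ?N d k Z) $ j * (B *\<^sub>v slice ?N d k Z) $ (n + j) -
           (A *\<^sub>v slice ?N d k Z) $ (n + j) * (B *\<^sub>v slice ?N d k Z) $ j))"
      using Z A B
      by (simp add: poisson_def q_idx_def v_idx_def partial_deriv_kronecker_form[of _ ?N]
          sum.swap[of _ "{..<n}"])
    also have "\<dots> = (\<Sum>k<d. (A *\<^sub>v slice ?N d k Z) \<bullet> (?P *\<^sub>v (B *\<^sub>v slice ?N d k Z)))"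
      using A B by (simp add: scalar_prod_poisson_mat mult_mat_vec_carrier[of _ ?N ?N])
    also have "\<dots> = kronecker_form d ?C Z"
      using Z C by (simp add: kronecker_form_slices[of _ ?N] form[symmetric] sum_distrib_left)
    finally show ?thesis .
  qed
qed

section \<open>Invariant forms and block-Laplacian matrices\<close>

abbreviation q_ones :: "nat \<Rightarrow> real vec" where
  "q_ones n \<equiv> vec (2 * n) (\<lambda>a. if a < n then 1 else 0)"

abbreviation v_ones :: "nat \<Rightarrow> real vec" where
  "v_ones n \<equiv> vec (2 * n) (\<lambda>a. if a < n then 0 else 1)"

lemma laplacian_iff:
  "laplacian A \<longleftrightarrow> (\<forall>i<dim_row A. (\<Sum>j<dim_col A. A $$ (i, j)) = 0)"
  by (auto simp: laplacian_def vec_eq_iff scalar_prod_def atLeast0LessThan)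

lemma all_less_double:
  fixes n :: nat
  shows "(\<forall>i<2 * n. P i) \<longleftrightarrow> (\<forall>i<n. P i) \<and> (\<forall>i<n. P (i + n))"
proof -
  have "P i" if "\<forall>i<n. P i" "\<forall>i<n. P (i + n)" "i < 2 * n" for i
    using that(1) that(2)[rule_format, of "i - n"] that(3) by (cases "i < n") auto
  then show ?thesis by auto
qed

lemma mult_q_ones_iff:
  assumes "A \<in> carrier_mat (2 * n) (2 * n)"
  shows "A *\<^sub>v q_ones n = 0\<^sub>v (2 * n) \<longleftrightarrow> (\<forall>i<2 * n. (\<Sum>j<n. A $$ (i, j)) = 0)"
  using assms by (auto simp: vec_eq_iff scalar_prod_def atLeast0LessThan sum_double)

lemma mult_v_ones_iff:
  assumes "A \<in> carrier_mat (2 * n) (2 * n)"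
  shows "A *\<^sub>v v_ones n = 0\<^sub>v (2 * n) \<longleftrightarrow> (\<forall>i<2 * n. (\<Sum>j<n. A $$ (i, j + n)) = 0)"
  using assms by (auto simp: vec_eq_iff scalar_prod_def atLeast0LessThan sum_double add.commute)

text \<open>Each of the two vectors selects the left or the right half of the columns; the upper and
  lower rows of the product then give the row sums of all four blocks.\<close>

lemma block_laplacian_iff:
  assumes "A \<in> carrier_mat (2 * n) (2 * n)"
  shows "block_laplacian n A \<longleftrightarrow> transpose_mat A = A \<and>
    A *\<^sub>v q_ones n = 0\<^sub>v (2 * n) \<and> A *\<^sub>v v_ones n = 0\<^sub>v (2 * n)"
  unfolding mult_q_ones_iff[OF assms] mult_v_ones_iff[OF assms] all_less_double
  using assms by (auto simp: block_laplacian_def split_block_def Let_def laplacian_iff)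

text \<open>Since \<open>v_idx\<close> continues the numbering of \<open>q_idx\<close>,
  \<open>pos\<close> with an index from n to 2n - 1 returns a velocity. Positions and velocities are
  thus handled uniformly as 2n vectors.\<close>

lemma pos_phase_point:
  assumes "\<And>i. i < n \<Longrightarrow> q i \<in> carrier_vec d" "\<And>i. i < n \<Longrightarrow> v i \<in> carrier_vec d" "a < 2 * n"
  shows "pos d (phase_point n d q v) a = (if a < n then q a else v (a - n))"
proof (cases "a < n")
  case True
  then show ?thesis by (simp add: phase_point_simps(1)[OF assms(1,2)])
next
  case False
  then have "vel n d (phase_point n d q v) (a - n) = v (a - n)"
    using assms by (intro phase_point_simps(2)) auto
  then show ?thesis using False by (simp add: vel_def pos_def v_idx_def q_idx_def)
qed

lemma phase_point_carrier [simp]: "phase_point n d q v \<in> carrier_vec (2 * n * d)"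
  by (simp add: phase_point_def)

lemma pos_carrier [simp]: "pos d Z a \<in> carrier_vec d"
  by (simp add: pos_def)

lemma pos_dim [simp]: "dim_vec (pos d Z a) = d"
  by (simp add: pos_def)

lemma vel_eq_pos: "vel n d Z i = pos d Z (n + i)"
  by (simp add: vel_def pos_def v_idx_def q_idx_def)

lemma slice_index: "a < N \<Longrightarrow> k < d \<Longrightarrow> slice N d k Z $ a = pos d Z a $ k"
  by (simp add: slice_def pos_def q_idx_def)

lemma slice_translate:
  assumes "q0 \<in> carrier_vec d" "k < d"
  shows "slice (2 * n) d k (translate n d q0 Z) = slice (2 * n) d k Z + q0 $ k \<cdot>\<^sub>v q_ones n"
  using assms
  by (intro eq_vecI)
    (auto simp: slice_index translate_def pos_phase_point vel_eq_pos)

lemma slice_boost: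
  assumes "v0 \<in> carrier_vec d" "k < d"
  shows "slice (2 * n) d k (boost n d v0 t Z) =
    slice (2 * n) d k Z + (t * v0 $ k) \<cdot>\<^sub>v q_ones n + v0 $ k \<cdot>\<^sub>v v_ones n"
  using assms
  by (intro eq_vecI) (auto simp: slice_index boost_def pos_phase_point vel_eq_pos)

lemma pos_rotate_phase:
  assumes "R \<in> carrier_mat d d" "a < 2 * n"
  shows "pos d (rotate_phase n d R Z) a = R *\<^sub>v pos d Z a"
  using assms by (simp add: rotate_phase_def pos_phase_point vel_eq_pos mult_mat_vec_carrier[of R d d])

text \<open>Only scalar products of positions and velocities occur here, which makes invariance
  under the orthogonal group visible, as the slice formula does for shifts. Linearity in
  \<open>A\<close> is read off from it too.\<close>

lemma kronecker_form_pos: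
  assumes "A \<in> carrier_mat N N" "Z \<in> carrier_vec (N * d)"
  shows "kronecker_form d A Z =
    1 / 2 * (\<Sum>a<N. \<Sum>b<N. A $$ (a, b) * (pos d Z a \<bullet> pos d Z b))"
proof -
  have "(\<Sum>k<d. slice N d k Z \<bullet> (A *\<^sub>v slice N d k Z)) =
      (\<Sum>k<d. \<Sum>a<N. \<Sum>b<N. A $$ (a, b) * (pos d Z a $ k * pos d Z b $ k))"
    using assms by (auto simp: scalar_prod_def atLeast0LessThan slice_index sum_distrib_left
        intro!: sum.cong)
  also have "\<dots> = (\<Sum>a<N. \<Sum>b<N. \<Sum>k<d. A $$ (a, b) * (pos d Z a $ k * pos d Z b $ k))"
    by (subst sum.swap) (intro sum.cong refl sum.swap)
  also have "\<dots> = (\<Sum>a<N. \<Sum>b<N. A $$ (a, b) * (pos d Z a \<bullet> pos d Z b))"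
    by (simp add: scalar_prod_def atLeast0LessThan sum_distrib_left)
  finally show ?thesis using assms by (simp add: kronecker_form_slices)
qed

lemma orthogonal_group_scalar_prod:
  assumes "R \<in> orthogonal_group d" "x \<in> carrier_vec d" "y \<in> carrier_vec d"
  shows "(R *\<^sub>v x) \<bullet> (R *\<^sub>v y) = x \<bullet> y"
proof -
  have R: "R \<in> carrier_mat d d" "transpose_mat R * R = 1\<^sub>m d"
    using assms(1) by (auto simp: orthogonal_group_def)
  have "(R *\<^sub>v x) \<bullet> (R *\<^sub>v y) = (transpose_mat R *\<^sub>v (R *\<^sub>v x)) \<bullet> y"
    using R assms by (intro transpose_vec_mult_scalar[symmetric, of _ d d]) auto
  also have "transpose_mat R *\<^sub>v (R *\<^sub>v x) = x"
    using R assms by (simp add: assoc_mult_mat_vec[of _ d d _ d, symmetric])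
  finally show ?thesis .
qed

section \<open>Shift invariance and kernel vectors\<close>

lemma quadratic_form_add_kernel:
  fixes A :: "real mat"
  assumes "A \<in> carrier_mat N N" "transpose_mat A = A" "x \<in> carrier_vec N" "w \<in> carrier_vec N"
    and "A *\<^sub>v w = 0\<^sub>v N"
  shows "(x + w) \<bullet> (A *\<^sub>v (x + w)) = x \<bullet> (A *\<^sub>v x)"
  using assms by (simp add: quadratic_form_add)

text \<open>The change of the form under the shift is affine in \<open>x\<close>. At
  \<open>x = 0\<close> its constant term is seen to vanish, and unit vectors then give the entries
  of \<open>A *\<^sub>v w\<close>.\<close>

lemma kernel_of_invariant_quadratic_form:
  fixes A :: "real mat"
  assumes A: "A \<in> carrier_mat N N" "transpose_mat A = A" and w: "w \<in> carrier_vec N"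
    and inv: "\<And>x. x \<in> carrier_vec N \<Longrightarrow> (x + w) \<bullet> (A *\<^sub>v (x + w)) = x \<bullet> (A *\<^sub>v x)"
  shows "A *\<^sub>v w = 0\<^sub>v N"
proof (rule eq_vecI)
  have Aw: "A *\<^sub>v w \<in> carrier_vec N" using A w by simp
  have *: "2 * (x \<bullet> (A *\<^sub>v w)) + w \<bullet> (A *\<^sub>v w) = 0" if "x \<in> carrier_vec N" for x
    using quadratic_form_add[OF A that w] inv[OF that] by simp
  have "w \<bullet> (A *\<^sub>v w) = 0" using *[of "0\<^sub>v N"] Aw by simp
  then show "(A *\<^sub>v w) $ i = 0\<^sub>v N $ i" if "i < dim_vec (0\<^sub>v N :: real vec)" for i
    using *[of "unit_vec N i"] Aw that by (simp add: scalar_prod_left_unit[of _ N])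
qed (use A in simp)

lemma kronecker_form_G_invariant:
  assumes "block_laplacian n A"
  shows "G_invariant n d (kronecker_form d A)"
proof -
  have A: "A \<in> carrier_mat (2 * n) (2 * n)" using assms by (simp add: block_laplacian_def)
  have sym: "transpose_mat A = A" and q: "A *\<^sub>v q_ones n = 0\<^sub>v (2 * n)"
    and v: "A *\<^sub>v v_ones n = 0\<^sub>v (2 * n)"
    using assms by (simp_all add: block_laplacian_iff[OF A])
  note kernel = quadratic_form_add_kernel[OF A sym]
  have zero: "c \<cdot>\<^sub>v 0\<^sub>v (2 * n) = 0\<^sub>v (2 * n)" for c :: real
    by (intro eq_vecI) auto
  have add_q: "(x + c \<cdot>\<^sub>v q_ones n) \<bullet> (A *\<^sub>v (x + c \<cdot>\<^sub>v q_ones n)) = x \<bullet> (A *\<^sub>v x)"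
    and add_v: "(x + c \<cdot>\<^sub>v v_ones n) \<bullet> (A *\<^sub>v (x + c \<cdot>\<^sub>v v_ones n)) = x \<bullet> (A *\<^sub>v x)"
    if "x \<in> carrier_vec (2 * n)" for x c
    by (rule kernel; use that in \<open>simp add: mult_mat_vec[OF A] q v zero\<close>)+
  show ?thesis unfolding G_invariant_def
  proof (intro ballI conjI allI)
    fix Z assume Z: "Z \<in> phase_space n d"
    show "kronecker_form d A (translate n d q0 Z) = kronecker_form d A Z" if "q0 \<in> carrier_vec d" for q0
    proof -
      have "translate n d q0 Z \<in> phase_space n d" by (simp add: translate_def)
      then show ?thesis
        using Z that by (simp add: kronecker_form_slices[OF A] slice_translate add_q)
    qed
    show "kronecker_form d A (boost n d v0 t Z) = kronecker_form d A Z" if "v0 \<in> carrier_vec d" for v0 t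
    proof -
      have "boost n d v0 t Z \<in> phase_space n d" by (simp add: boost_def)
      then show ?thesis
        using Z that by (simp add: kronecker_form_slices[OF A] slice_boost add_q add_v)
    qed
    show "kronecker_form d A (rotate_phase n d R Z) = kronecker_form d A Z"
      if "R \<in> orthogonal_group d" for R
    proof -
      have "rotate_phase n d R Z \<in> phase_space n d" by (simp add: rotate_phase_def)
      moreover have "R \<in> carrier_mat d d" using that by (simp add: orthogonal_group_def)
      ultimately show ?thesis
        using Z that
        by (simp add: kronecker_form_pos[OF A] pos_rotate_phase orthogonal_group_scalar_prod)
    qed
  qed
qed

section \<open>Signed permutations and the shape of rotation-invariant forms\<close>

lemma quadratic_formsE:
  assumes "Q \<in> quadratic_forms N"
  obtains B where "B \<in> carrier_mat N N" "transpose_mat B = B"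
    "Q = (\<lambda>Z\<in>carrier_vec N. 1 / 2 * (Z \<bullet> (B *\<^sub>v Z)))"
proof -
  obtain c :: "nat \<Rightarrow> nat \<Rightarrow> real"
    where c: "\<And>Z. Z \<in> carrier_vec N \<Longrightarrow> Q Z = (\<Sum>a<N. \<Sum>b<N. c a b * (Z $ a * Z $ b))"
    using assms unfolding quadratic_forms_def by blast
  \<comment> \<open>The sum with the transpose counts every coefficient twice, which the factor 1/2
    of the form compensates.\<close>
  define B where "B = mat N N (\<lambda>(a, b). c a b + c b a)"
  have "Q Z = 1 / 2 * (Z \<bullet> (B *\<^sub>v Z))" if Z: "Z \<in> carrier_vec N" for Z
  proof -
    have "Z \<bullet> (B *\<^sub>v Z) = (\<Sum>a<N. \<Sum>b<N. (c a b + c b a) * (Z $ a * Z $ b))"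
      using Z by (auto simp: B_def scalar_prod_def atLeast0LessThan sum_distrib_left algebra_simps
          intro!: sum.cong)
    also have "\<dots> = Q Z + (\<Sum>a<N. \<Sum>b<N. c b a * (Z $ a * Z $ b))"
      by (simp add: c[OF Z] distrib_right sum.distrib)
    also have "(\<Sum>a<N. \<Sum>b<N. c b a * (Z $ a * Z $ b)) = Q Z"
      unfolding c[OF Z] by (subst sum.swap) (simp add: mult.commute)
    finally show ?thesis by simp
  qed
  moreover have "Q \<in> extensional (carrier_vec N)" using assms by (simp add: quadratic_forms_def)
  ultimately have "Q = (\<lambda>Z\<in>carrier_vec N. 1 / 2 * (Z \<bullet> (B *\<^sub>v Z)))"
    by (intro extensionalityI[where A = "carrier_vec N"]) auto
  moreover have "B \<in> carrier_mat N N" "transpose_mat B = B"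
    by (auto simp: B_def intro!: eq_matI)
  ultimately show ?thesis using that by blast
qed

text \<open>Two kinds are used: the reflection of a single coordinate and the exchange of two
  coordinates. Together they leave only scalar matrices as commutant on the d-dimensional
  space.\<close>

definition signed_perm_mat :: "nat \<Rightarrow> (nat \<Rightarrow> real) \<Rightarrow> (nat \<Rightarrow> nat) \<Rightarrow> real mat" where
  "signed_perm_mat d \<epsilon> \<sigma> = mat d d (\<lambda>(i, j). if j = \<sigma> i then \<epsilon> i else 0)"

lemma signed_perm_mat_orthogonal:
  assumes "\<And>i. \<epsilon> i * \<epsilon> i = 1" "\<And>i. i < d \<Longrightarrow> \<sigma> i < d" "\<And>i. \<sigma> (\<sigma> i) = i"
  shows "signed_perm_mat d \<epsilon> \<sigma> \<in> orthogonal_group d"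
proof -
  have "(\<Sum>m<d. (if i = \<sigma> m then \<epsilon> m else 0) * (if j = \<sigma> m then \<epsilon> m else 0)) = (if i = j then 1 else 0)"
    if "i < d" for i j
  proof -
    have "(\<Sum>m<d. (if i = \<sigma> m then \<epsilon> m else 0) * (if j = \<sigma> m then \<epsilon> m else 0)) =
        (\<Sum>m<d. if m = \<sigma> i then if i = j then 1 else 0 else 0)"
      using assms by (intro sum.cong) auto
    then show ?thesis using assms(2)[OF that] by simp
  qed
  then have "transpose_mat (signed_perm_mat d \<epsilon> \<sigma>) * signed_perm_mat d \<epsilon> \<sigma> = 1\<^sub>m d"
    by (intro eq_matI) (auto simp: signed_perm_mat_def scalar_prod_def atLeast0LessThan)
  then show ?thesis by (simp add: orthogonal_group_def signed_perm_mat_def)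
qed

lemma rotate_phase_signed_perm_mat:
  assumes "i < 2 * n * d" "\<And>i. i < d \<Longrightarrow> \<sigma> i < d"
  shows "rotate_phase n d (signed_perm_mat d \<epsilon> \<sigma>) Z $ i =
    \<epsilon> (i mod d) * Z $ (i div d * d + \<sigma> (i mod d))"
proof -
  have d: "d > 0" using assms(1) by (cases d) auto
  let ?R = "signed_perm_mat d \<epsilon> \<sigma>" and ?a = "i div d" and ?k = "i mod d"
  have a: "?a < 2 * n" and k: "?k < d" using assms d by (auto simp: less_mult_imp_div_less)
  have "rotate_phase n d ?R Z $ i = pos d (rotate_phase n d ?R Z) ?a $ ?k"
    using k by (simp add: pos_def q_idx_def)
  also have "\<dots> = (?R *\<^sub>v pos d Z ?a) $ ?k"
    using a by (simp add: pos_rotate_phase signed_perm_mat_def)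
  also have "\<dots> = (\<Sum>l<d. (if l = \<sigma> ?k then \<epsilon> ?k else 0) * pos d Z ?a $ l)"
    using k by (simp add: signed_perm_mat_def scalar_prod_def atLeast0LessThan pos_def)
  also have "\<dots> = (\<Sum>l<d. if l = \<sigma> ?k then \<epsilon> ?k * pos d Z ?a $ l else 0)"
    by (intro sum.cong) auto
  also have "\<dots> = \<epsilon> ?k * Z $ (?a * d + \<sigma> ?k)"
    using assms(2)[OF k] by (simp add: pos_def q_idx_def)
  finally show ?thesis .
qed

text \<open>View \<open>B\<close> as 2n by 2n blocks of size \<open>d\<close>. Invariance makes
  every block commute with the orthogonal matrices. Reflections annihilate its off-diagonal entries
  and exchanges equate its diagonal ones, so each block is a multiple of the identity; the factors
  form \<open>A\<close>.\<close>

lemma G_invariant_imp_kronecker_one: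
  assumes B: "B \<in> carrier_mat (2 * n * d) (2 * n * d)" "transpose_mat B = B"
    and inv: "G_invariant n d (\<lambda>Z\<in>phase_space n d. 1 / 2 * (Z \<bullet> (B *\<^sub>v Z)))"
  obtains A where "A \<in> carrier_mat (2 * n) (2 * n)" "transpose_mat A = A" "B = A \<otimes>\<^sub>K 1\<^sub>m d"
proof -
  let ?N = "2 * n * d"
  let ?e = "unit_vec ?N :: nat \<Rightarrow> real vec"
  \<comment> \<open>Polarised invariance: when \<open>R\<close> sends two unit vectors to multiples
    of unit vectors, comparing the form on each of them and on their sum relates two entries of
    \<open>B\<close>.\<close>
  have polar: "B $$ (i', j') * (\<epsilon> i * \<epsilon> j) = B $$ (i, j)"
    if R: "R \<in> orthogonal_group d" and ij: "i < ?N" "j < ?N" "i' < ?N" "j' < ?N"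
      and i': "rotate_phase n d R (?e i) = \<epsilon> i \<cdot>\<^sub>v ?e i'"
      and j': "rotate_phase n d R (?e j) = \<epsilon> j \<cdot>\<^sub>v ?e j'"
    for R i j i' j' and \<epsilon> :: "nat \<Rightarrow> real"
  proof -
    have RC: "R \<in> carrier_mat d d" using R by (simp add: orthogonal_group_def)
    have add: "rotate_phase n d R (?e i + ?e j) = rotate_phase n d R (?e i) + rotate_phase n d R (?e j)"
    proof (rule eq_vecI)
      fix a assume "a < dim_vec (rotate_phase n d R (?e i) + rotate_phase n d R (?e j))"
      then have a: "a < ?N" by (simp add: rotate_phase_def phase_point_def)
      then have "d > 0" by (cases d) auto
      then have b: "a div d < 2 * n" "a mod d < d" using a by (auto simp: less_mult_imp_div_less)
      have idx: "X $ a = pos d X (a div d) $ (a mod d)" for X :: "real vec"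
        using b by (simp add: pos_def q_idx_def)
      have "pos d (?e i + ?e j) (a div d) = pos d (?e i) (a div d) + pos d (?e j) (a div d)"
        using pair_index_less[OF b(1)] by (auto simp: pos_def q_idx_def intro!: eq_vecI)
      then have "pos d (rotate_phase n d R (?e i + ?e j)) (a div d) =
          pos d (rotate_phase n d R (?e i)) (a div d) + pos d (rotate_phase n d R (?e j)) (a div d)"
        using RC b by (simp add: pos_rotate_phase mult_add_distrib_mat_vec[of _ d d])
      then show "rotate_phase n d R (?e i + ?e j) $ a =
          (rotate_phase n d R (?e i) + rotate_phase n d R (?e j)) $ a"
        using a b idx
        by (simp add: idx[of "rotate_phase n d R (?e i + ?e j)"] rotate_phase_def phase_point_def
            del: index_vec) (simp add: pos_def q_idx_def)
    qed (simp add: rotate_phase_def phase_point_def)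
    have form: "rotate_phase n d R Z \<bullet> (B *\<^sub>v rotate_phase n d R Z) = Z \<bullet> (B *\<^sub>v Z)"
      if "Z \<in> phase_space n d" for Z
      using inv R that unfolding G_invariant_def by (auto simp: rotate_phase_def)
    have entry: "?e p \<bullet> (B *\<^sub>v ?e q) = B $$ (p, q)" if "p < ?N" "q < ?N" for p q
      using that B by (simp add: scalar_prod_left_unit[of _ ?N] mult_mat_vec_def)
    have "(\<epsilon> i \<cdot>\<^sub>v ?e i') \<bullet> (B *\<^sub>v (\<epsilon> j \<cdot>\<^sub>v ?e j')) = ?e i \<bullet> (B *\<^sub>v ?e j)"
      using form[of "?e i + ?e j"] form[of "?e i"] form[of "?e j"]
        quadratic_form_add[OF B, of "?e i" "?e j"]
        quadratic_form_add[OF B, of "\<epsilon> i \<cdot>\<^sub>v ?e i'" "\<epsilon> j \<cdot>\<^sub>v ?e j'"]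
      by (simp add: add i' j')
    moreover have "(\<epsilon> i \<cdot>\<^sub>v ?e i') \<bullet> (B *\<^sub>v (\<epsilon> j \<cdot>\<^sub>v ?e j')) = B $$ (i', j') * (\<epsilon> i * \<epsilon> j)"
      using B ij mult_mat_vec_carrier[OF B(1), of "?e j'"]
      by (simp add: mult_mat_vec[OF B(1)] entry)
    ultimately show ?thesis using ij by (simp add: entry)
  qed
  \<comment> \<open>Permuting components inside each vector acts on the indices of phase space as an
    involution; this solves for the preimage of an index.\<close>
  have div_mod: "(i div d * d + \<sigma> (i mod d) = a * d + k) \<longleftrightarrow> (i = a * d + \<sigma> k)"
    if \<sigma>: "\<And>i. i < d \<Longrightarrow> \<sigma> i < d" "\<And>i. \<sigma> (\<sigma> i) = i" and "k < d" for i a k \<sigma>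
  proof -
    have "i mod d < d" using \<open>k < d\<close> by simp
    then have "\<sigma> (i mod d) < d" "\<sigma> k < d" using \<sigma> \<open>k < d\<close> by auto
    have "i div d * d + \<sigma> (i mod d) = a * d + k \<longleftrightarrow> i div d = a \<and> \<sigma> (i mod d) = k"
      using \<open>\<sigma> (i mod d) < d\<close> \<open>k < d\<close>
      by (metis add.commute div_mult_self1_is_m div_mult_self3 div_less add_0 mod_less mod_mult_self3 gr_implies_not0)
    also have "\<dots> \<longleftrightarrow> i div d = a \<and> i mod d = \<sigma> k"
      using \<sigma>(2) by metis
    also have "\<dots> \<longleftrightarrow> i = a * d + \<sigma> k"
      using \<open>\<sigma> k < d\<close> by (metis add.commute div_mult_mod_eq div_mult_self3 div_less add_0 mod_less mod_mult_self3 gr_implies_not0)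
    finally show ?thesis .
  qed
  \<comment> \<open>Reversing component \<open>k\<close> everywhere multiplies this entry by -1, as
    \<open>l\<close> differs from \<open>k\<close>. The entry therefore equals its own
    negative.\<close>
  have off_diag: "B $$ (a * d + k, b * d + l) = 0"
    if h: "a < 2 * n" "b < 2 * n" "k < d" "l < d" "k \<noteq> l" for a b k l
  proof -
    define \<epsilon> :: "nat \<Rightarrow> real" where "\<epsilon> i = (if i = k then -1 else 1)" for i
    have u: "rotate_phase n d (signed_perm_mat d \<epsilon> id) (?e i) = \<epsilon> (i mod d) \<cdot>\<^sub>v ?e i" if "i < ?N" for i
    proof (rule eq_vecI)
      fix j assume "j < dim_vec (\<epsilon> (i mod d) \<cdot>\<^sub>v ?e i)"
      then have "j < ?N" by simp
      then show "rotate_phase n d (signed_perm_mat d \<epsilon> id) (?e i) $ j = (\<epsilon> (i mod d) \<cdot>\<^sub>v ?e i) $ j"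
        using that by (subst rotate_phase_signed_perm_mat) (auto simp: unit_vec_def)
    qed (simp add: rotate_phase_def phase_point_def)
    have "signed_perm_mat d \<epsilon> id \<in> orthogonal_group d"
      by (rule signed_perm_mat_orthogonal) (auto simp: \<epsilon>_def)
    from polar[OF this, of "a * d + k" "b * d + l" "a * d + k" "b * d + l" "\<lambda>i. \<epsilon> (i mod d)"]
    show ?thesis using h by (simp add: u pair_index_less \<epsilon>_def)
  qed
  \<comment> \<open>Exchanging components 0 and \<open>k\<close> carries the k-th diagonal entry of
    each block to the first.\<close>
  have diag: "B $$ (a * d + k, b * d + k) = B $$ (a * d, b * d)"
    if h: "a < 2 * n" "b < 2 * n" "k < d" for a b k
  proof -
    define \<sigma> :: "nat \<Rightarrow> nat" where "\<sigma> i = (if i = k then 0 else if i = 0 then k else i)" for i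
    have \<sigma>: "\<And>i. i < d \<Longrightarrow> \<sigma> i < d" "\<And>i. \<sigma> (\<sigma> i) = i" using h by (auto simp: \<sigma>_def)
    have u: "rotate_phase n d (signed_perm_mat d (\<lambda>_. 1) \<sigma>) (?e (c * d + k)) = 1 \<cdot>\<^sub>v ?e (c * d)"
      if "c < 2 * n" for c
    proof (rule eq_vecI)
      fix j assume "j < dim_vec (1 \<cdot>\<^sub>v ?e (c * d))"
      then have j: "j < ?N" by simp
      then have "d > 0" by (cases d) auto
      then have "j div d * d + \<sigma> (j mod d) < ?N"
        using j \<sigma>(1) by (intro pair_index_less) (auto simp: less_mult_imp_div_less)
      then show "rotate_phase n d (signed_perm_mat d (\<lambda>_. 1) \<sigma>) (?e (c * d + k)) $ j = (1 \<cdot>\<^sub>v ?e (c * d)) $ j"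
        using j h that pair_index_less[OF that h(3)] pair_index_less[OF that \<open>d > 0\<close>]
          div_mod[OF \<sigma> h(3), of j c]
        by (subst rotate_phase_signed_perm_mat) (auto simp: \<sigma>(1), auto simp: \<sigma>_def)
    qed (simp add: rotate_phase_def phase_point_def)
    have "signed_perm_mat d (\<lambda>_. 1) \<sigma> \<in> orthogonal_group d"
      using \<sigma> by (intro signed_perm_mat_orthogonal) auto
    from polar[OF this, of "a * d + k" "b * d + k" "a * d" "b * d" "\<lambda>_. 1"]
    show ?thesis using h pair_index_less[of a "2 * n" 0 d] pair_index_less[of b "2 * n" 0 d]
      by (simp add: u pair_index_less)
  qed
  define A where "A = mat (2 * n) (2 * n) (\<lambda>(a, b). B $$ (a * d, b * d))"
  have A: "A \<in> carrier_mat (2 * n) (2 * n)" by (simp add: A_def)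
  have Bsym: "B $$ (i, j) = B $$ (j, i)" if "i < ?N" "j < ?N" for i j
    using that B by (metis carrier_matD index_transpose_mat(1))
  have "transpose_mat A = A"
  proof (cases "d = 0")
    \<comment> \<open>Here \<open>B\<close> is empty, but all entries of \<open>A\<close> read the
      same unspecified value at position (0, 0), so \<open>A\<close> is still symmetric.\<close>
    case True
    then show ?thesis by (auto simp: A_def intro!: eq_matI)
  next
    case False
    then have "a * d < ?N" if "a < 2 * n" for a
      using pair_index_less[OF that, of 0 d] by simp
    then show ?thesis using Bsym by (auto simp: A_def intro!: eq_matI)
  qed
  moreover have "B = A \<otimes>\<^sub>K 1\<^sub>m d"
  proof (rule eq_matI)
    fix i j assume "i < dim_row (A \<otimes>\<^sub>K 1\<^sub>m d)" "j < dim_col (A \<otimes>\<^sub>K 1\<^sub>m d)"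
    then have ij: "i < ?N" "j < ?N" by (auto simp: kronecker_def A_def)
    then have "d > 0" by (cases d) auto
    then have b: "i div d < 2 * n" "j div d < 2 * n" "i mod d < d" "j mod d < d"
      using ij by (auto simp: less_mult_imp_div_less)
    then have "(A \<otimes>\<^sub>K 1\<^sub>m d) $$ (i, j) = (if i mod d = j mod d then A $$ (i div d, j div d) else 0)"
      using A ij by (simp add: kronecker_def)
    also have "\<dots> = B $$ (i div d * d + i mod d, j div d * d + j mod d)"
    proof (cases "i mod d = j mod d")
      case True
      show ?thesis using diag[OF b(1,2,3)] b unfolding True[symmetric] by (simp add: A_def)
    qed (use off_diag[OF b] in simp)
    finally show "B $$ (i, j) = (A \<otimes>\<^sub>K 1\<^sub>m d) $$ (i, j)" by simp
  qed (use A B in \<open>auto simp: kronecker_def\<close>)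
  ultimately show ?thesis using A that by blast
qed

text \<open>On a point supported in slice 0, translation along the first axis adds
  \<open>q_ones\<close> to that slice, and a boost along this axis at time 0 adds
  \<open>v_ones\<close>; the other slices stay zero. Invariance of the form of \<open>A\<close>
  under these two shifts puts both vectors into its kernel.\<close>

lemma invariant_formsE:
  assumes "Q \<in> invariant_forms n d" "d \<ge> 1"
  obtains A where "block_laplacian n A" "Q = kronecker_form d A"
proof -
  have Q: "Q \<in> quadratic_forms (2 * n * d)" and inv: "G_invariant n d Q"
    using assms by (auto simp: invariant_forms_def)
  obtain B where B: "B \<in> carrier_mat (2 * n * d) (2 * n * d)" "transpose_mat B = B"
    and QB: "Q = (\<lambda>Z\<in>phase_space n d. 1 / 2 * (Z \<bullet> (B *\<^sub>v Z)))"
    using quadratic_formsE[OF Q] .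
  obtain A where A: "A \<in> carrier_mat (2 * n) (2 * n)" "transpose_mat A = A" and BA: "B = A \<otimes>\<^sub>K 1\<^sub>m d"
    using G_invariant_imp_kronecker_one[OF B] inv QB by blast
  have QA: "Q = kronecker_form d A"
    using A by (simp add: QB BA kronecker_form_def)
  let ?N = "2 * n" and ?u = "unit_vec d 0 :: real vec"
  have u: "?u $ k = (if k = 0 then 1 else 0)" if "k < d" for k
    using that assms(2) by simp
  have "(x + q_ones n) \<bullet> (A *\<^sub>v (x + q_ones n)) = x \<bullet> (A *\<^sub>v x)" if x: "x \<in> carrier_vec ?N" for x
  proof -
    let ?Z = "embed_slice ?N d 0 x"
    have "kronecker_form d A (translate n d ?u ?Z) = kronecker_form d A ?Z"
      using inv QA by (simp add: G_invariant_def)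
    moreover have "kronecker_form d A (translate n d ?u ?Z) =
        1 / 2 * ((x + q_ones n) \<bullet> (A *\<^sub>v (x + q_ones n)))"
      using A x assms(2)
      by (intro kronecker_form_single_slice[of _ ?N _ 0])
        (auto simp: slice_translate slice_embed_slice u simp del: index_unit_vec, auto simp: translate_def)
    ultimately show ?thesis
      using kronecker_form_embed_slice[OF A(1) x, of 0 d] assms(2) by simp
  qed
  moreover have "(x + v_ones n) \<bullet> (A *\<^sub>v (x + v_ones n)) = x \<bullet> (A *\<^sub>v x)" if x: "x \<in> carrier_vec ?N" for x
  proof -
    let ?Z = "embed_slice ?N d 0 x"
    have "kronecker_form d A (boost n d ?u 0 ?Z) = kronecker_form d A ?Z"
      using inv QA by (simp add: G_invariant_def)
    moreover have "kronecker_form d A (boost n d ?u 0 ?Z) =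
        1 / 2 * ((x + v_ones n) \<bullet> (A *\<^sub>v (x + v_ones n)))"
      using A x assms(2)
      by (intro kronecker_form_single_slice[of _ ?N _ 0])
        (auto simp: slice_boost slice_embed_slice u simp del: index_unit_vec, auto simp: boost_def)
    ultimately show ?thesis
      using kronecker_form_embed_slice[OF A(1) x, of 0 d] assms(2) by simp
  qed
  ultimately have "A *\<^sub>v q_ones n = 0\<^sub>v ?N" "A *\<^sub>v v_ones n = 0\<^sub>v ?N"
    using A by (auto intro!: kernel_of_invariant_quadratic_form)
  then have "block_laplacian n A" using A by (simp add: block_laplacian_iff)
  then show ?thesis using QA that by blast
qed

lemma kronecker_form_invariant:
  assumes "block_laplacian n A"
  shows "kronecker_form d A \<in> invariant_forms n d"
  using assms kronecker_form_quadratic[of A "2 * n" d] kronecker_form_G_invariant[OF assms, of d]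
  by (simp add: invariant_forms_def block_laplacian_def)

lemma invariant_forms_iff:
  assumes "Q \<in> quadratic_forms (2 * n * d)" "d \<ge> 1"
  shows "Q \<in> invariant_forms n d \<longleftrightarrow> (\<exists>A. block_laplacian n A \<and>
    (\<forall>Z\<in>phase_space n d. Q Z = 1 / 2 * (Z \<bullet> ((A \<otimes>\<^sub>K 1\<^sub>m d) *\<^sub>v Z))))"
proof
  assume "Q \<in> invariant_forms n d"
  then obtain A where "block_laplacian n A" "Q = kronecker_form d A"
    using assms(2) by (rule invariant_formsE)
  then show "\<exists>A. block_laplacian n A \<and>
      (\<forall>Z\<in>phase_space n d. Q Z = 1 / 2 * (Z \<bullet> ((A \<otimes>\<^sub>K 1\<^sub>m d) *\<^sub>v Z)))"
    by (auto simp: kronecker_form_def block_laplacian_def intro!: exI[of _ A])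
next
  assume "\<exists>A. block_laplacian n A \<and>
    (\<forall>Z\<in>phase_space n d. Q Z = 1 / 2 * (Z \<bullet> ((A \<otimes>\<^sub>K 1\<^sub>m d) *\<^sub>v Z)))"
  then obtain A where A: "block_laplacian n A"
    and Q: "\<And>Z. Z \<in> phase_space n d \<Longrightarrow> Q Z = 1 / 2 * (Z \<bullet> ((A \<otimes>\<^sub>K 1\<^sub>m d) *\<^sub>v Z))" by blast
  have "Q = kronecker_form d A"
    using A Q assms(1)
    by (intro extensionalityI[where A = "phase_space n d"])
      (auto simp: quadratic_forms_def kronecker_form_def block_laplacian_def)
  then show "Q \<in> invariant_forms n d" using kronecker_form_invariant[OF A] by simp
qed

section \<open>Reduction to relative coordinates\<close>

text \<open>The library versions of these rules mention the inner dimensions only in their carrier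
  premises, which makes them unsuitable for rewriting products of rectangular matrices.\<close>

lemma mat_mult_assoc:
  fixes A B C :: "'a :: semiring_0 mat"
  assumes "dim_col A = dim_row B" "dim_col B = dim_row C"
  shows "A * B * C = A * (B * C)"
  using assms by (intro assoc_mult_mat[of _ "dim_row A" "dim_col A" _ "dim_col B" _ "dim_col C"]) auto

lemma mat_mult_add_distrib:
  fixes A B C :: "'a :: semiring_0 mat"
  assumes "dim_row B = dim_row C" "dim_col B = dim_col C" "dim_col A = dim_row B"
  shows "A * (B + C) = A * B + A * C"
  using assms by (intro mult_add_distrib_mat[of _ "dim_row A" "dim_col A" _ "dim_col B"]) auto

lemma mat_add_mult_distrib:
  fixes A B C :: "'a :: semiring_0 mat"
  assumes "dim_row A = dim_row B" "dim_col A = dim_col B" "dim_col A = dim_row C"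
  shows "(A + B) * C = A * C + B * C"
  using assms by (intro add_mult_distrib_mat[of _ "dim_row A" "dim_col A" _ _ "dim_col C"]) auto

lemma mat_mult_minus_distrib:
  fixes A B C :: "'a :: ring mat"
  assumes "dim_row B = dim_row C" "dim_col B = dim_col C" "dim_col A = dim_row B"
  shows "A * (B - C) = A * B - A * C"
  using assms by (intro mult_minus_distrib_mat[of _ "dim_row A" "dim_col A" _ "dim_col B"]) auto

lemma mat_minus_mult_distrib:
  fixes A B C :: "'a :: ring mat"
  assumes "dim_row A = dim_row B" "dim_col A = dim_col B" "dim_col A = dim_row C"
  shows "(A - B) * C = A * C - B * C"
  using assms by (intro minus_mult_distrib_mat[of _ "dim_row A" "dim_col A" _ _ "dim_col C"]) auto

lemma mat_transpose_mult:
  fixes A B :: "'a :: comm_semiring_0 mat"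
  assumes "dim_col A = dim_row B"
  shows "transpose_mat (A * B) = transpose_mat B * transpose_mat A"
  using assms by (intro transpose_mult[of _ "dim_row A" "dim_col A" _ "dim_col B"]) auto

lemma mat_mult_smult:
  fixes A B :: "'a :: comm_ring mat"
  assumes "dim_col A = dim_row B"
  shows "A * (c \<cdot>\<^sub>m B) = c \<cdot>\<^sub>m (A * B)" "(c \<cdot>\<^sub>m A) * B = c \<cdot>\<^sub>m (A * B)"
  using assms by (auto intro!: eq_matI)

lemma uminus_smult_mat:
  fixes A :: "'a :: comm_ring mat"
  shows "- (c \<cdot>\<^sub>m A) = c \<cdot>\<^sub>m - A"
  by (auto intro!: eq_matI)

lemma uminus_add_mat:
  fixes A B :: "'a :: ab_group_add mat"
  assumes "dim_row A = dim_row B" "dim_col A = dim_col B"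
  shows "- (A + B) = - A + - B"
  using assms by (auto intro!: eq_matI)

lemma uminus_minus_mat:
  fixes A B :: "'a :: ab_group_add mat"
  assumes "dim_row A = dim_row B" "dim_col A = dim_col B"
  shows "- (A - B) = - A - - B"
  using assms by (auto intro!: eq_matI)

lemma mat_mult_uminus:
  fixes A B :: "'a :: ring mat"
  assumes "dim_col A = dim_row B"
  shows "A * (- B) = - (A * B)" "(- A) * B = - (A * B)"
  using assms by (auto intro!: eq_matI)

definition diff_mat :: "nat \<Rightarrow> real mat" where
  "diff_mat n = mat (n - 1) n (\<lambda>(i, j). if j = i then 1 else if j = n - 1 then -1 else 0)"

text \<open>The momenta conjugate to the relative positions \<open>q\<^sub>i - q\<^sub>n\<close>, as combinations of velocities,
  are \<open>m\<^sub>i (v\<^sub>i - V)\<close> with \<open>V\<close> the velocity of the center of mass. Applied to positions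
  instead of velocities, these combinations form a dual basis to the differences.\<close>

definition dual_diff_mat :: "nat \<Rightarrow> (nat \<Rightarrow> real) \<Rightarrow> real mat" where
  "dual_diff_mat n m =
     mat (n - 1) n (\<lambda>(i, j). m i * ((if j = i then 1 else 0) - m j / (\<Sum>l<n. m l)))"

text \<open>Write E, D, W for \<open>dual_diff_mat\<close>, \<open>diff_mat\<close>,
  \<open>inv_mass_mat\<close>. With E on the positions and D on the velocities, the bracket matrix
  of the new coordinates has upper right block \<open>E W D^T\<close>, which duality turns into the
  identity.\<close>

definition reduction_mat :: "nat \<Rightarrow> (nat \<Rightarrow> real) \<Rightarrow> real mat" where
  "reduction_mat n m =
     four_block_mat (dual_diff_mat n m) (0\<^sub>m (n - 1) n) (0\<^sub>m (n - 1) n) (diff_mat n)"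

text \<open>The relations \<open>E W D^T = 1\<close> and \<open>D W E^T = 1\<close> make this a
  right inverse of \<open>reduction_mat\<close>: it returns the configuration with center of mass
  and total momentum zero.\<close>

definition lift_mat :: "nat \<Rightarrow> (nat \<Rightarrow> real) \<Rightarrow> real mat" where
  "lift_mat n m =
     four_block_mat (inv_mass_mat n m * transpose_mat (diff_mat n)) (0\<^sub>m n (n - 1))
       (0\<^sub>m n (n - 1)) (inv_mass_mat n m * transpose_mat (dual_diff_mat n m))"

text \<open>The projection along the vector of ones onto the vectors with center of mass 0.\<close>

definition barycentric_mat :: "nat \<Rightarrow> (nat \<Rightarrow> real) \<Rightarrow> real mat" where
  "barycentric_mat n m = mat n n (\<lambda>(j, l). (if j = l then 1 else 0) - m l / (\<Sum>l<n. m l))"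

lemma reduction_block_carriers:
  "diff_mat n \<in> carrier_mat (n - 1) n" "dual_diff_mat n m \<in> carrier_mat (n - 1) n"
  "barycentric_mat n m \<in> carrier_mat n n"
  by (simp_all add: diff_mat_def dual_diff_mat_def barycentric_mat_def)

declare reduction_block_carriers [simp] reduction_block_carriers [unfolded One_nat_def, simp]

lemma reduction_mat_dim [simp]:
  "dim_row (reduction_mat n m) = 2 * (n - 1)" "dim_col (reduction_mat n m) = 2 * n"
  by (simp_all add: reduction_mat_def dual_diff_mat_def diff_mat_def)

lemma lift_mat_dim [simp]:
  "dim_row (lift_mat n m) = 2 * n" "dim_col (lift_mat n m) = 2 * (n - 1)"
  by (simp_all add: lift_mat_def inv_mass_mat_def dual_diff_mat_def diff_mat_def)

lemma poisson_mat_dim [simp]: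
  "dim_row (poisson_mat n m) = 2 * n" "dim_col (poisson_mat n m) = 2 * n"
  by (simp_all add: poisson_mat_def inv_mass_mat_def)

section \<open>Duality of the two systems of differences\<close>

lemma mat_mult_entry:
  assumes "A \<in> carrier_mat nr n" "B \<in> carrier_mat n nc" "i < nr" "j < nc"
  shows "(A * B) $$ (i, j) = (\<Sum>l<n. A $$ (i, l) * B $$ (l, j))"
  using assms by (simp add: scalar_prod_def atLeast0LessThan)

lemma inv_mass_mat_mult:
  assumes "B \<in> carrier_mat n k" "i < n" "j < k"
  shows "(inv_mass_mat n m * B) $$ (i, j) = B $$ (i, j) / m i"
proof -
  have "(inv_mass_mat n m * B) $$ (i, j) = (\<Sum>l<n. (if i = l then 1 / m i else 0) * B $$ (l, j))"
    using assms by (simp add: inv_mass_mat_def scalar_prod_def atLeast0LessThan)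
  also have "\<dots> = (\<Sum>l<n. if i = l then B $$ (i, j) / m i else 0)"
    by (intro sum.cong) auto
  finally show ?thesis using assms by simp
qed

lemma sum_diff_mat_row:
  fixes g :: "nat \<Rightarrow> real"
  assumes "k < n - 1"
  shows "(\<Sum>j<n. diff_mat n $$ (k, j) * g j) = g k - g (n - 1)"
proof -
  have "(\<Sum>j<n. diff_mat n $$ (k, j) * g j) =
      (\<Sum>j<n. (if j = k then g j else 0) - (if j = n - 1 then g j else 0))"
    using assms by (intro sum.cong) (auto simp: diff_mat_def)
  then show ?thesis using assms by (simp add: sum_subtractf)
qed

text \<open>A zero-sum vector is recovered from its first n - 1 entries: the last column of
  \<open>diff_mat\<close> consists of -1, and minus the sum of the other entries is the last
  one.\<close>

lemma sum_diff_mat_col: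
  fixes g :: "nat \<Rightarrow> real"
  assumes "(\<Sum>i<n. g i) = 0" "j < n"
  shows "(\<Sum>i<n - 1. diff_mat n $$ (i, j) * g i) = g j"
proof (cases "j = n - 1")
  case True
  have "{..<n} = insert (n - 1) {..<n - 1}" using assms by auto
  then have "g (n - 1) + (\<Sum>i<n - 1. g i) = 0" using assms(1) by simp
  moreover have "(\<Sum>i<n - 1. diff_mat n $$ (i, j) * g i) = (\<Sum>i<n - 1. - g i)"
    using True assms by (intro sum.cong) (auto simp: diff_mat_def)
  ultimately show ?thesis using True by (simp add: sum_negf)
next
  case False
  have "(\<Sum>i<n - 1. diff_mat n $$ (i, j) * g i) = (\<Sum>i<n - 1. if i = j then g i else 0)"
    using False assms by (intro sum.cong) (auto simp: diff_mat_def)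
  then show ?thesis using False assms by simp
qed

text \<open>Dividing entry \<open>j\<close> of row \<open>i\<close> of the dual differences by
  \<open>m j\<close> leaves a unit vector minus the constant \<open>m i / M\<close>, with M the
  total mass. Differences annihilate constants.\<close>

lemma dual_diff_inv_mass_diff:
  assumes "\<And>i. i < n \<Longrightarrow> m i \<noteq> 0"
  shows "dual_diff_mat n m * (inv_mass_mat n m * transpose_mat (diff_mat n)) = 1\<^sub>m (n - 1)"
proof (rule eq_matI)
  fix i k assume "i < dim_row (1\<^sub>m (n - 1) :: real mat)" "k < dim_col (1\<^sub>m (n - 1) :: real mat)"
  then have ik: "i < n - 1" "k < n - 1" by auto
  let ?W = "inv_mass_mat n m * transpose_mat (diff_mat n)"
  have W: "?W \<in> carrier_mat n (n - 1)" by (intro mult_carrier_mat[of _ n n]) auto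
  have D: "transpose_mat (diff_mat n) \<in> carrier_mat n (n - 1)"
    by simp
  have "(dual_diff_mat n m * ?W) $$ (i, k) = (\<Sum>j<n. dual_diff_mat n m $$ (i, j) * ?W $$ (j, k))"
    using ik by (intro mat_mult_entry[OF reduction_block_carriers(2) W])
  also have "\<dots> = (\<Sum>j<n. diff_mat n $$ (k, j) *
      ((if i = j then 1 else 0) - m i / (\<Sum>l<n. m l)))"
    using ik assms carrier_matD[OF reduction_block_carriers(1)[of n]]
    by (intro sum.cong)
      (auto simp: inv_mass_mat_mult[OF D] dual_diff_mat_def field_simps)
  also have "\<dots> = (if i = k then 1 else 0)"
    using ik by (simp add: sum_diff_mat_row)
  finally show "(dual_diff_mat n m * ?W) $$ (i, k) = 1\<^sub>m (n - 1) $$ (i, k)" using ik by simp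
qed (auto simp: dual_diff_mat_def diff_mat_def)

text \<open>Column \<open>l\<close> of the dual differences, continued to the last body by the same
  formula, has the sum \<open>m l - M * (m l / M) = 0\<close> with M the total mass, so
  \<open>sum_diff_mat_col\<close> recovers it in full.\<close>

lemma inv_mass_diff_dual_diff:
  assumes "\<And>i. i < n \<Longrightarrow> m i \<noteq> 0" "(\<Sum>i<n. m i) \<noteq> 0"
  shows "inv_mass_mat n m * (transpose_mat (diff_mat n) * dual_diff_mat n m) = barycentric_mat n m"
proof (rule eq_matI)
  fix j l assume "j < dim_row (barycentric_mat n m)" "l < dim_col (barycentric_mat n m)"
  then have jl: "j < n" "l < n" by (auto simp: barycentric_mat_def)
  let ?M = "\<Sum>i<n. m i"
  let ?g = "\<lambda>i. m i * ((if l = i then 1 else 0) - m l / ?M)"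
  have "(\<Sum>i<n. ?g i) = (\<Sum>i<n. (if l = i then m i else 0) - m i * (m l / ?M))"
    by (intro sum.cong) (auto simp: algebra_simps)
  also have "\<dots> = 0" using jl assms(2) by (simp add: sum_subtractf sum_distrib_right[symmetric] del: times_divide_eq_right) simp
  finally have g: "(\<Sum>i<n. ?g i) = 0" .
  have "(transpose_mat (diff_mat n) * dual_diff_mat n m) $$ (j, l) =
      (\<Sum>i<n - 1. diff_mat n $$ (i, j) * ?g i)"
    using jl by (simp add: scalar_prod_def atLeast0LessThan dual_diff_mat_def diff_mat_def)
  also have "\<dots> = ?g j" by (rule sum_diff_mat_col[OF g jl(1)])
  finally have "(transpose_mat (diff_mat n) * dual_diff_mat n m) $$ (j, l) = ?g j" .
  moreover have "transpose_mat (diff_mat n) * dual_diff_mat n m \<in> carrier_mat n n"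
    by (intro mult_carrier_mat[of _ n "n - 1"]) auto
  ultimately show "(inv_mass_mat n m * (transpose_mat (diff_mat n) * dual_diff_mat n m)) $$ (j, l) =
      barycentric_mat n m $$ (j, l)"
    using jl assms(1)[OF jl(1)] by (simp add: inv_mass_mat_mult[of _ n n] barycentric_mat_def del: index_mult_mat(1))
qed (auto simp: inv_mass_mat_def dual_diff_mat_def barycentric_mat_def)

text \<open>The two orders agree because \<open>D^T E\<close> is symmetric, with entries
  \<open>m j * ((if j = l then 1 else 0) - m l / M)\<close>.\<close>

lemma inv_mass_dual_diff_diff:
  assumes "\<And>i. i < n \<Longrightarrow> m i \<noteq> 0" "(\<Sum>i<n. m i) \<noteq> 0"
  shows "inv_mass_mat n m * (transpose_mat (dual_diff_mat n m) * diff_mat n) = barycentric_mat n m"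
proof (rule eq_matI)
  fix j l assume "j < dim_row (barycentric_mat n m)" "l < dim_col (barycentric_mat n m)"
  then have jl: "j < n" "l < n" by (auto simp: barycentric_mat_def)
  let ?M = "\<Sum>i<n. m i"
  let ?g = "\<lambda>i. m i * ((if j = i then 1 else 0) - m j / ?M)"
  have "(\<Sum>i<n. ?g i) = (\<Sum>i<n. (if j = i then m i else 0) - m i * (m j / ?M))"
    by (intro sum.cong) (auto simp: algebra_simps)
  also have "\<dots> = 0" using jl assms(2) by (simp add: sum_subtractf sum_distrib_right[symmetric] del: times_divide_eq_right) simp
  finally have g: "(\<Sum>i<n. ?g i) = 0" .
  have "(transpose_mat (dual_diff_mat n m) * diff_mat n) $$ (j, l) =
      (\<Sum>i<n - 1. diff_mat n $$ (i, l) * ?g i)"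
    using jl by (simp add: scalar_prod_def atLeast0LessThan dual_diff_mat_def diff_mat_def mult.commute)
  also have "\<dots> = ?g l" by (rule sum_diff_mat_col[OF g jl(2)])
  finally have "(transpose_mat (dual_diff_mat n m) * diff_mat n) $$ (j, l) = ?g l" .
  moreover have "transpose_mat (dual_diff_mat n m) * diff_mat n \<in> carrier_mat n n"
    by (intro mult_carrier_mat[of _ n "n - 1"]) auto
  ultimately show "(inv_mass_mat n m * (transpose_mat (dual_diff_mat n m) * diff_mat n)) $$ (j, l) =
      barycentric_mat n m $$ (j, l)"
    using jl assms(1)[OF jl(1)]
    by (simp add: inv_mass_mat_mult[of _ n n] barycentric_mat_def field_simps del: index_mult_mat(1))
qed (auto simp: inv_mass_mat_def dual_diff_mat_def diff_mat_def barycentric_mat_def)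

text \<open>The projection differs from the identity by a matrix whose columns are all multiples of
  the vector of ones, which \<open>B\<close> annihilates.\<close>

lemma laplacian_mult_barycentric:
  assumes "B \<in> carrier_mat n n" "laplacian B"
  shows "B * barycentric_mat n m = B"
proof (rule eq_matI)
  fix i l assume "i < dim_row B" "l < dim_col B"
  then have il: "i < n" "l < n" using assms by auto
  have "(B * barycentric_mat n m) $$ (i, l) =
      (\<Sum>j<n. (if j = l then B $$ (i, j) else 0) - B $$ (i, j) * (m l / (\<Sum>l<n. m l)))"
    using il assms(1) by (auto simp: barycentric_mat_def scalar_prod_def atLeast0LessThan algebra_simps
        intro!: sum.cong)
  also have "\<dots> = B $$ (i, l)"
    using il assms by (simp add: sum_subtractf sum_distrib_right[symmetric] laplacian_iff
        del: times_divide_eq_right)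
  finally show "(B * barycentric_mat n m) $$ (i, l) = B $$ (i, l)" .
qed (use assms in \<open>auto simp: barycentric_mat_def\<close>)

lemma transpose_inv_mass_mat: "transpose_mat (inv_mass_mat n m) = inv_mass_mat n m"
  by (rule eq_matI) (auto simp: inv_mass_mat_def)

lemma reduction_block_dims [simp]:
  "dim_row (diff_mat n) = n - 1" "dim_col (diff_mat n) = n"
  "dim_row (dual_diff_mat n m) = n - 1" "dim_col (dual_diff_mat n m) = n"
  "dim_row (inv_mass_mat n m) = n" "dim_col (inv_mass_mat n m) = n"
  by (simp_all add: diff_mat_def dual_diff_mat_def inv_mass_mat_def)

lemma diff_inv_mass_dual_diff:
  assumes "\<And>i. i < n \<Longrightarrow> m i \<noteq> 0"
  shows "diff_mat n * (inv_mass_mat n m * transpose_mat (dual_diff_mat n m)) = 1\<^sub>m (n - 1)"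
  using arg_cong[OF dual_diff_inv_mass_diff[of n m, OF assms], where f = transpose_mat]
  by (simp add: mat_transpose_mult transpose_inv_mass_mat mat_mult_assoc del: assoc_mult_mat)

lemma zero_mult_mat:
  fixes B :: "'a :: semiring_0 mat"
  assumes "dim_row B = n"
  shows "0\<^sub>m k n * B = 0\<^sub>m k (dim_col B)"
  using assms by (intro left_mult_zero_mat) auto

section \<open>Poisson structure and inversion of the reduction\<close>

lemma reduction_mat_poisson_mat:
  assumes "\<And>i. i < n \<Longrightarrow> m i \<noteq> 0"
  shows "reduction_mat n m * (poisson_mat n m * transpose_mat (reduction_mat n m)) =
    symplectic_unit (n - 1)"
proof -
  let ?E = "dual_diff_mat n m" and ?D = "diff_mat n" and ?W = "inv_mass_mat n m" and ?k = "n - 1"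
  have W: "?W * transpose_mat ?E \<in> carrier_mat n ?k" "?W * transpose_mat ?D \<in> carrier_mat n ?k"
    by (auto intro!: mult_carrier_mat[of _ n n])
  have t: "transpose_mat (reduction_mat n m) =
      four_block_mat (transpose_mat ?E) (0\<^sub>m n ?k) (0\<^sub>m n ?k) (transpose_mat ?D)"
    unfolding reduction_mat_def
    by (subst transpose_four_block_mat[of _ ?k n _ n _ ?k]) auto
  have uminus_zero: "- 0\<^sub>m k l = (0\<^sub>m k l :: real mat)" for k l
    by (rule eq_matI) auto
  have PU: "poisson_mat n m * transpose_mat (reduction_mat n m) =
      four_block_mat (0\<^sub>m n ?k) (?W * transpose_mat ?D) (- (?W * transpose_mat ?E)) (0\<^sub>m n ?k)"
    unfolding t poisson_mat_def
    using W by (subst mult_four_block_mat[of _ n n _ n _ n _ _ ?k _ ?k])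
      (auto simp: mat_mult_uminus)
  have "reduction_mat n m * (poisson_mat n m * transpose_mat (reduction_mat n m)) =
      four_block_mat (?E * 0\<^sub>m n ?k + 0\<^sub>m ?k n * - (?W * transpose_mat ?E))
        (?E * (?W * transpose_mat ?D) + 0\<^sub>m ?k n * 0\<^sub>m n ?k)
        (0\<^sub>m ?k n * 0\<^sub>m n ?k + ?D * - (?W * transpose_mat ?E))
        (0\<^sub>m ?k n * (?W * transpose_mat ?D) + ?D * 0\<^sub>m n ?k)"
    unfolding PU unfolding reduction_mat_def
    using W by (intro mult_four_block_mat[of _ ?k n _ n _ ?k _ _ ?k _ ?k]) auto
  also have "\<dots> = symplectic_unit ?k"
    using dual_diff_inv_mass_diff[of n m] diff_inv_mass_dual_diff[of n m] assms uminus_zero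
    by (simp add: zero_mult_mat mat_mult_uminus symplectic_unit_def del: assoc_mult_mat)
  finally show ?thesis .
qed

lemma reduction_mat_lift_mat:
  assumes "\<And>i. i < n \<Longrightarrow> m i \<noteq> 0"
  shows "reduction_mat n m * lift_mat n m = 1\<^sub>m (2 * (n - 1))"
proof -
  let ?E = "dual_diff_mat n m" and ?D = "diff_mat n" and ?W = "inv_mass_mat n m" and ?k = "n - 1"
  have W: "?W * transpose_mat ?E \<in> carrier_mat n ?k" "?W * transpose_mat ?D \<in> carrier_mat n ?k"
    by (auto intro!: mult_carrier_mat[of _ n n])
  have "reduction_mat n m * lift_mat n m =
      four_block_mat (?E * (?W * transpose_mat ?D) + 0\<^sub>m ?k n * 0\<^sub>m n ?k)
        (?E * 0\<^sub>m n ?k + 0\<^sub>m ?k n * (?W * transpose_mat ?E))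
        (0\<^sub>m ?k n * (?W * transpose_mat ?D) + ?D * 0\<^sub>m n ?k)
        (0\<^sub>m ?k n * 0\<^sub>m n ?k + ?D * (?W * transpose_mat ?E))"
    unfolding reduction_mat_def lift_mat_def
    using W by (intro mult_four_block_mat[of _ ?k n _ n _ ?k _ _ ?k _ ?k]) auto
  also have "\<dots> = 1\<^sub>m (2 * ?k)"
    using dual_diff_inv_mass_diff[of n m] diff_inv_mass_dual_diff[of n m] assms
    by (simp add: zero_mult_mat mult_2 del: assoc_mult_mat)
  finally show ?thesis .
qed

lemma lift_mat_reduction_mat:
  assumes "\<And>i. i < n \<Longrightarrow> m i \<noteq> 0" "(\<Sum>i<n. m i) \<noteq> 0"
  shows "lift_mat n m * reduction_mat n m =
    four_block_mat (barycentric_mat n m) (0\<^sub>m n n) (0\<^sub>m n n) (barycentric_mat n m)"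
proof -
  let ?E = "dual_diff_mat n m" and ?D = "diff_mat n" and ?W = "inv_mass_mat n m" and ?k = "n - 1"
  have W: "?W * transpose_mat ?E \<in> carrier_mat n ?k" "?W * transpose_mat ?D \<in> carrier_mat n ?k"
    by (auto intro!: mult_carrier_mat[of _ n n])
  have "lift_mat n m * reduction_mat n m =
      four_block_mat (?W * transpose_mat ?D * ?E + 0\<^sub>m n ?k * 0\<^sub>m ?k n)
        (?W * transpose_mat ?D * 0\<^sub>m ?k n + 0\<^sub>m n ?k * ?D)
        (0\<^sub>m n ?k * ?E + ?W * transpose_mat ?E * 0\<^sub>m ?k n)
        (0\<^sub>m n ?k * 0\<^sub>m ?k n + ?W * transpose_mat ?E * ?D)"
    unfolding reduction_mat_def lift_mat_def
    using W by (intro mult_four_block_mat[of _ n ?k _ ?k _ n _ _ n _ n]) auto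
  also have "\<dots> = four_block_mat (barycentric_mat n m) (0\<^sub>m n n) (0\<^sub>m n n) (barycentric_mat n m)"
    using inv_mass_diff_dual_diff[OF assms] inv_mass_dual_diff_diff[OF assms] W
    by (simp add: zero_mult_mat mat_mult_assoc del: assoc_mult_mat)
  finally show ?thesis .
qed

text \<open>Lifting after reducing is only a projection, but what it removes lies along the two
  block vectors of ones. Hence \<open>A\<close> factors through relative coordinates.\<close>

lemma block_laplacian_mult_lift_reduction:
  assumes A: "block_laplacian n A" and m: "\<And>i. i < n \<Longrightarrow> m i \<noteq> 0" "(\<Sum>i<n. m i) \<noteq> 0"
  shows "A * (lift_mat n m * reduction_mat n m) = A"
proof -
  obtain A1 A2 A3 A4 where s: "split_block A n n = (A1, A2, A3, A4)"
    by (metis prod_cases4)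
  have dim: "dim_row A = n + n" "dim_col A = n + n" using A by (auto simp: block_laplacian_def)
  note c = split_block[OF s dim]
  have L: "laplacian A1" "laplacian A2" "laplacian A3" "laplacian A4"
    using A s by (auto simp: block_laplacian_def)
  let ?K = "barycentric_mat n m"
  have K: "lift_mat n m * reduction_mat n m = four_block_mat ?K (0\<^sub>m n n) (0\<^sub>m n n) ?K"
    using m by (rule lift_mat_reduction_mat)
  have "A * (lift_mat n m * reduction_mat n m) =
      four_block_mat (A1 * ?K + A2 * 0\<^sub>m n n) (A1 * 0\<^sub>m n n + A2 * ?K)
        (A3 * ?K + A4 * 0\<^sub>m n n) (A3 * 0\<^sub>m n n + A4 * ?K)"
    unfolding K c(5)
    using c(1-4) by (intro mult_four_block_mat[of _ n n _ n _ n _ _ n _ n]) auto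
  also have "\<dots> = A"
    using c L by (simp add: laplacian_mult_barycentric)
  finally show ?thesis .
qed

text \<open>Differences have row sum 1 - 1, and row \<open>i\<close> of the dual differences has row
  sum \<open>m i * (1 - M / M)\<close> with M the total mass.\<close>

lemma reduction_mat_mult_ones:
  assumes "(\<Sum>i<n. m i) \<noteq> 0"
  shows "reduction_mat n m *\<^sub>v q_ones n = 0\<^sub>v (2 * (n - 1))"
    and "reduction_mat n m *\<^sub>v v_ones n = 0\<^sub>v (2 * (n - 1))"
proof -
  let ?M = "\<Sum>i<n. m i"
  have D: "(\<Sum>j<n. diff_mat n $$ (i, j)) = 0" if "i < n - 1" for i
    using sum_diff_mat_row[OF that, of "\<lambda>_. 1"] by simp
  have E: "(\<Sum>j<n. dual_diff_mat n m $$ (i, j)) = 0" if "i < n - 1" for i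
  proof -
    have "(\<Sum>j<n. dual_diff_mat n m $$ (i, j)) =
        m i * (\<Sum>j<n. (if j = i then 1 else 0) - m j / ?M)"
      using that by (simp add: dual_diff_mat_def sum_distrib_left)
    also have "\<dots> = 0"
      using that assms by (simp add: sum_subtractf sum_divide_distrib[symmetric])
    finally show ?thesis .
  qed
  let ?U = "reduction_mat n m"
  have U: "?U $$ (i, j) = (if i < n - 1 then dual_diff_mat n m $$ (i, j) else 0)"
    "?U $$ (i, n + j) = (if i < n - 1 then 0 else diff_mat n $$ (i - (n - 1), j))"
    if "i < 2 * (n - 1)" "j < n" for i j
    using that by (auto simp: reduction_mat_def)
  have q: "(?U *\<^sub>v q_ones n) $ i = (\<Sum>j<n. ?U $$ (i, j))"
    and v: "(?U *\<^sub>v v_ones n) $ i = (\<Sum>j<n. ?U $$ (i, n + j))" if "i < 2 * (n - 1)" for i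
    using that by (simp_all add: scalar_prod_def atLeast0LessThan sum_double)
  show "?U *\<^sub>v q_ones n = 0\<^sub>v (2 * (n - 1))"
  proof (rule eq_vecI)
    fix i assume "i < dim_vec (0\<^sub>v (2 * (n - 1)) :: real vec)"
    then show "(?U *\<^sub>v q_ones n) $ i = 0\<^sub>v (2 * (n - 1)) $ i"
      using E[of i] by (cases "i < n - 1") (simp_all add: q U del: index_mult_mat_vec)
  qed simp
  show "?U *\<^sub>v v_ones n = 0\<^sub>v (2 * (n - 1))"
  proof (rule eq_vecI)
    fix i assume "i < dim_vec (0\<^sub>v (2 * (n - 1)) :: real vec)"
    then show "(?U *\<^sub>v v_ones n) $ i = 0\<^sub>v (2 * (n - 1)) $ i"
      using D[of "i - (n - 1)"] by (cases "i < n - 1") (simp_all add: v U del: index_mult_mat_vec)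
  qed simp
qed

lemma block_laplacian_congruence:
  assumes S: "S \<in> carrier_mat (2 * (n - 1)) (2 * (n - 1))" "transpose_mat S = S"
    and m: "(\<Sum>i<n. m i) \<noteq> 0"
  shows "block_laplacian n (transpose_mat (reduction_mat n m) * (S * reduction_mat n m))"
proof -
  let ?U = "reduction_mat n m"
  let ?A = "transpose_mat ?U * (S * ?U)"
  have U: "?U \<in> carrier_mat (2 * (n - 1)) (2 * n)" by (auto intro: carrier_matI)
  have SU: "S * ?U \<in> carrier_mat (2 * (n - 1)) (2 * n)"
    using S U by (auto intro!: mult_carrier_mat[of _ _ "2 * (n - 1)"])
  have A: "?A \<in> carrier_mat (2 * n) (2 * n)"
    using SU U by (auto intro!: mult_carrier_mat[of _ _ "2 * (n - 1)"])
  have zero: "?A *\<^sub>v w = 0\<^sub>v (2 * n)" if "w \<in> carrier_vec (2 * n)" "?U *\<^sub>v w = 0\<^sub>v (2 * (n - 1))" for w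
  proof -
    have "?A *\<^sub>v w = transpose_mat ?U *\<^sub>v (S *\<^sub>v (?U *\<^sub>v w))"
      using that(1) SU S U
      by (simp add: assoc_mult_mat_vec[of _ "2 * n" "2 * (n - 1)" _ "2 * n"]
          assoc_mult_mat_vec[of _ "2 * (n - 1)" "2 * (n - 1)" _ "2 * n"] del: assoc_mult_mat_vec)
    moreover have "S *\<^sub>v 0\<^sub>v (2 * (n - 1)) = 0\<^sub>v (2 * (n - 1))"
      using S by (intro eq_vecI) auto
    moreover have "transpose_mat ?U *\<^sub>v 0\<^sub>v (2 * (n - 1)) = 0\<^sub>v (2 * n)"
      using U by (intro eq_vecI) auto
    ultimately show ?thesis using that(2) by simp
  qed
  have "transpose_mat ?A = ?A"
    using S by (simp add: mat_transpose_mult mat_mult_assoc del: assoc_mult_mat)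
  then show ?thesis
    unfolding block_laplacian_iff[OF A] using zero reduction_mat_mult_ones[OF m] by simp
qed

section \<open>The isomorphism\<close>

lemma transpose_symplectic_unit: "transpose_mat (symplectic_unit N) = - symplectic_unit N"
  by (rule eq_matI) (auto simp: symplectic_unit_def)

lemma symplectic_unit_square: "symplectic_unit N * symplectic_unit N = - 1\<^sub>m (2 * N)"
proof -
  have "symplectic_unit N * symplectic_unit N =
      four_block_mat (0\<^sub>m N N * 0\<^sub>m N N + 1\<^sub>m N * - 1\<^sub>m N) (0\<^sub>m N N * 1\<^sub>m N + 1\<^sub>m N * 0\<^sub>m N N)
        (- 1\<^sub>m N * 0\<^sub>m N N + 0\<^sub>m N N * - 1\<^sub>m N) (- 1\<^sub>m N * 1\<^sub>m N + 0\<^sub>m N N * 0\<^sub>m N N)"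
    unfolding symplectic_unit_def by (intro mult_four_block_mat[of _ N N _ N _ N _ _ N _ N]) auto
  also have "\<dots> = - 1\<^sub>m (2 * N)"
    by (rule eq_matI) auto
  finally show ?thesis .
qed

text \<open>For Hamiltonian \<open>X\<close> the matrix \<open>- J X\<close> is symmetric; it is the matrix of the corresponding
  form in relative coordinates.\<close>

definition form_mat :: "nat \<Rightarrow> (nat \<Rightarrow> real) \<Rightarrow> real mat \<Rightarrow> real mat" where
  "form_mat n m X = transpose_mat (reduction_mat n m) *
     (- (symplectic_unit (n - 1) * X) * reduction_mat n m)"

lemma form_mat_dim [simp]:
  "dim_row (form_mat n m X) = 2 * n" "dim_col (form_mat n m X) = 2 * n"
  by (simp_all add: form_mat_def)

lemma hamiltonian_mats_dim:
  assumes "X \<in> hamiltonian_mats N"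
  shows "dim_row X = 2 * N" "dim_col X = 2 * N"
  using hamiltonian_matsD(1)[OF assms] by auto

lemma hamiltonian_symmetric:
  assumes "X \<in> hamiltonian_mats N"
  shows "transpose_mat (- (symplectic_unit N * X)) = - (symplectic_unit N * X)"
proof -
  have "transpose_mat (- (symplectic_unit N * X)) = - (transpose_mat X * transpose_mat (symplectic_unit N))"
    using hamiltonian_mats_dim[OF assms] by (simp add: transpose_uminus mat_transpose_mult)
  also have "\<dots> = transpose_mat X * symplectic_unit N"
    using hamiltonian_mats_dim[OF assms] by (simp add: transpose_symplectic_unit mat_mult_uminus)
  finally show ?thesis using hamiltonian_matsD(2)[OF assms] by simp
qed

lemma block_laplacian_form_mat:
  assumes "X \<in> hamiltonian_mats (n - 1)" "(\<Sum>i<n. m i) \<noteq> 0"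
  shows "block_laplacian n (form_mat n m X)"
  unfolding form_mat_def
  using assms hamiltonian_symmetric[OF assms(1)] hamiltonian_mats_dim[OF assms(1)]
  by (intro block_laplacian_congruence) (auto intro!: carrier_matI)

lemma form_mat_add:
  assumes "X \<in> hamiltonian_mats (n - 1)" "Y \<in> hamiltonian_mats (n - 1)"
  shows "form_mat n m (X + Y) = form_mat n m X + form_mat n m Y"
  using hamiltonian_mats_dim[OF assms(1)] hamiltonian_mats_dim[OF assms(2)]
  by (simp add: form_mat_def mat_mult_uminus mat_mult_assoc mat_mult_add_distrib
      mat_add_mult_distrib uminus_add_mat del: assoc_mult_mat)

lemma form_mat_smult:
  assumes "X \<in> hamiltonian_mats (n - 1)"
  shows "form_mat n m (c \<cdot>\<^sub>m X) = c \<cdot>\<^sub>m form_mat n m X"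
  using hamiltonian_mats_dim[OF assms]
  by (simp add: form_mat_def mat_mult_uminus mat_mult_assoc mat_mult_smult uminus_smult_mat del: assoc_mult_mat)

text \<open>Even the single products correspond: \<open>(- J A) J (- J B) = - J (A B)\<close>
  because J squares to -1. With J in place of - J the right-hand side would be the negative of the
  form of \<open>A B\<close>, and the brackets would differ by a sign.\<close>

lemma form_mat_bracket:
  assumes m: "\<And>i. i < n \<Longrightarrow> m i \<noteq> 0"
    and X: "X \<in> hamiltonian_mats (n - 1)" and Y: "Y \<in> hamiltonian_mats (n - 1)"
  shows "form_mat n m X * poisson_mat n m * form_mat n m Y -
      form_mat n m Y * poisson_mat n m * form_mat n m X = form_mat n m (X * Y - Y * X)"
proof -
  let ?J = "symplectic_unit (n - 1)" and ?U = "reduction_mat n m" and ?P = "poisson_mat n m"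
  have UPU: "?U * (?P * (transpose_mat ?U * C)) = ?J * C" if "dim_row C = 2 * (n - 1)" for C
    using arg_cong[OF reduction_mat_poisson_mat[of n m], where f = "\<lambda>B. B * C"] m that
    by (simp add: mat_mult_assoc del: assoc_mult_mat)
  have JJ: "?J * (?J * C) = - C" if "dim_row C = 2 * (n - 1)" for C
  proof -
    have "?J * (?J * C) = - 1\<^sub>m (2 * (n - 1)) * C"
      using that by (simp add: mat_mult_assoc[symmetric] symplectic_unit_square del: assoc_mult_mat)
    then show ?thesis using that by (simp add: mat_mult_uminus)
  qed
  have prod: "form_mat n m A * ?P * form_mat n m B = form_mat n m (A * B)"
    if "A \<in> hamiltonian_mats (n - 1)" "B \<in> hamiltonian_mats (n - 1)" for A B
    using hamiltonian_mats_dim[OF that(1)] hamiltonian_mats_dim[OF that(2)]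
    by (simp add: form_mat_def mat_mult_assoc mat_mult_uminus UPU JJ[unfolded One_nat_def] del: assoc_mult_mat)
  have "form_mat n m (X * Y - Y * X) = form_mat n m (X * Y) - form_mat n m (Y * X)"
    using hamiltonian_mats_dim[OF X] hamiltonian_mats_dim[OF Y]
    by (simp add: form_mat_def mat_mult_uminus mat_mult_assoc mat_mult_minus_distrib
        mat_minus_mult_distrib uminus_minus_mat del: assoc_mult_mat)
  then show ?thesis using X Y by (simp add: prod)
qed

text \<open>An explicit left inverse of \<open>form_mat\<close>, which yields injectivity: lifting
  undoes the congruence, and \<open>J (- J X) = X\<close>.\<close>

lemma lift_mat_form_mat:
  assumes "\<And>i. i < n \<Longrightarrow> m i \<noteq> 0" "X \<in> hamiltonian_mats (n - 1)"
  shows "symplectic_unit (n - 1) * (transpose_mat (lift_mat n m) * (form_mat n m X * lift_mat n m)) = X"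
proof -
  let ?J = "symplectic_unit (n - 1)" and ?U = "reduction_mat n m" and ?V = "lift_mat n m"
  note d = hamiltonian_mats_dim[OF assms(2)]
  have UV: "?U * ?V = 1\<^sub>m (2 * (n - 1))" using assms(1) by (rule reduction_mat_lift_mat)
  have VU: "transpose_mat ?V * (transpose_mat ?U * C) = C" if "dim_row C = 2 * (n - 1)" for C
  proof -
    have "transpose_mat ?V * (transpose_mat ?U * C) = transpose_mat (?U * ?V) * C"
      using that by (simp add: mat_transpose_mult mat_mult_assoc del: assoc_mult_mat)
    then show ?thesis using that by (simp add: UV)
  qed
  have "?J * (transpose_mat ?V * (form_mat n m X * ?V)) = - (?J * (?J * X))"
    using d by (simp add: form_mat_def mat_mult_assoc mat_mult_uminus VU UV del: assoc_mult_mat)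
  also have "\<dots> = - ((?J * ?J) * X)" using d by (simp add: mat_mult_assoc del: assoc_mult_mat)
  also have "\<dots> = X" using d by (simp add: symplectic_unit_square mat_mult_uminus)
  finally show ?thesis .
qed

lemma form_mat_surj:
  assumes A: "block_laplacian n A"
    and m: "\<And>i. i < n \<Longrightarrow> m i \<noteq> 0" "(\<Sum>i<n. m i) \<noteq> 0"
  obtains X where "X \<in> hamiltonian_mats (n - 1)" "form_mat n m X = A"
proof -
  let ?N = "n - 1"
  let ?J = "symplectic_unit ?N" and ?U = "reduction_mat n m" and ?V = "lift_mat n m"
  have dA: "dim_row A = 2 * n" "dim_col A = 2 * n" and sym: "transpose_mat A = A"
    using A by (auto simp: block_laplacian_def)
  \<comment> \<open>The matrix of the form in relative coordinates, obtained by evaluating it on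
    lifted configurations.\<close>
  define S where "S = transpose_mat ?V * (A * ?V)"
  have dS: "dim_row S = 2 * ?N" "dim_col S = 2 * ?N" by (simp_all add: S_def)
  have S: "transpose_mat S = S"
    using dA sym by (simp add: S_def mat_transpose_mult mat_mult_assoc del: assoc_mult_mat)
  have JJ: "?J * (?J * S) = - S"
  proof -
    have "?J * (?J * S) = (?J * ?J) * S" using dS by (simp add: mat_mult_assoc del: assoc_mult_mat)
    then show ?thesis using dS by (simp add: symplectic_unit_square mat_mult_uminus)
  qed
  \<comment> \<open>The witness \<open>?J * S\<close> solves \<open>- (J X) = S\<close>; it is
    Hamiltonian because \<open>S\<close> is symmetric.\<close>
  have "?J * S \<in> hamiltonian_mats ?N"
  proof (rule hamiltonian_matsI)
    show "?J * S \<in> carrier_mat (2 * ?N) (2 * ?N)" using dS by (intro carrier_matI) auto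
    have "transpose_mat (?J * S) * ?J = - (S * (?J * ?J))"
      using dS S
      by (simp add: mat_transpose_mult transpose_symplectic_unit mat_mult_assoc mat_mult_uminus
          del: assoc_mult_mat)
    also have "\<dots> = S" using dS by (simp add: symplectic_unit_square mat_mult_uminus)
    finally show "transpose_mat (?J * S) * ?J = - (?J * (?J * S))" unfolding JJ by simp
  qed
  moreover have "form_mat n m (?J * S) = A"
  proof -
    have right: "A * (?V * ?U) = A" using A m by (rule block_laplacian_mult_lift_reduction)
    \<comment> \<open>By symmetry of \<open>A\<close>, the projection can be absorbed on the left as
      well.\<close>
    have left: "transpose_mat ?U * (transpose_mat ?V * A) = A"
      using arg_cong[OF right, of transpose_mat] dA sym
      by (simp add: mat_transpose_mult mat_mult_assoc del: assoc_mult_mat)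
    have "form_mat n m (?J * S) = transpose_mat ?U * (S * ?U)"
      unfolding form_mat_def JJ by simp
    also have "\<dots> = transpose_mat ?U * (transpose_mat ?V * (A * (?V * ?U)))"
      using dA by (simp add: S_def mat_mult_assoc del: assoc_mult_mat)
    also have "\<dots> = A" by (simp add: right left)
    finally show ?thesis .
  qed
  ultimately show ?thesis using that by blast
qed

section \<open>Linearity in the matrix and transport of structure\<close>

lemma kronecker_form_add:
  assumes "A \<in> carrier_mat N N" "B \<in> carrier_mat N N"
  shows "kronecker_form d (A + B) = (\<lambda>Z\<in>carrier_vec (N * d). kronecker_form d A Z + kronecker_form d B Z)"
proof
  fix Z
  have AB: "A + B \<in> carrier_mat N N" using assms by simp
  show "kronecker_form d (A + B) Z = (\<lambda>Z\<in>carrier_vec (N * d). kronecker_form d A Z + kronecker_form d B Z) Z"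
  proof (cases "Z \<in> carrier_vec (N * d)")
    case True
    then show ?thesis
      using assms by (simp add: kronecker_form_pos[OF AB] kronecker_form_pos[OF assms(1)]
          kronecker_form_pos[OF assms(2)] sum.distrib distrib_right add_divide_distrib)
  next
    case False
    then show ?thesis using carrier_matD(2)[OF AB] by (simp only: kronecker_form_def) simp
  qed
qed

lemma kronecker_form_smult:
  assumes "A \<in> carrier_mat N N"
  shows "kronecker_form d (c \<cdot>\<^sub>m A) = (\<lambda>Z\<in>carrier_vec (N * d). c * kronecker_form d A Z)"
proof
  fix Z
  have cA: "c \<cdot>\<^sub>m A \<in> carrier_mat N N" using assms by simp
  show "kronecker_form d (c \<cdot>\<^sub>m A) Z = (\<lambda>Z\<in>carrier_vec (N * d). c * kronecker_form d A Z) Z"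
  proof (cases "Z \<in> carrier_vec (N * d)")
    case True
    then show ?thesis
      using assms by (simp add: kronecker_form_pos[OF cA] kronecker_form_pos[OF assms]
          sum_distrib_left mult.assoc mult.left_commute)
  next
    case False
    then show ?thesis using carrier_matD(2)[OF cA] by (simp only: kronecker_form_def) simp
  qed
qed

text \<open>The map leaves the known algebra, so each element of the target is some
  \<open>\<psi> x\<close> and each axiom there, including closure and the Jacobi identity, is the
  image of one in \<open>L\<close>. The isomorphism asserted runs backwards, hence the inverse of
  \<open>\<psi>\<close>.\<close>

lemma lie_algebra_transport:
  fixes R :: "('r, 'x) ring_scheme" and L :: "('r, 'a, 'y) module_scheme"
    and M :: "('r, 'b, 'z) module_scheme"
  assumes "lie_algebra R L" and bij: "bij_betw \<psi> (carrier L) (carrier M)"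
    and zero: "\<zero>\<^bsub>M\<^esub> = \<psi> \<zero>\<^bsub>L\<^esub>"
    and add: "\<And>x y. x \<in> carrier L \<Longrightarrow> y \<in> carrier L \<Longrightarrow> \<psi> x \<oplus>\<^bsub>M\<^esub> \<psi> y = \<psi> (x \<oplus>\<^bsub>L\<^esub> y)"
    and smult: "\<And>a x. a \<in> carrier R \<Longrightarrow> x \<in> carrier L \<Longrightarrow> a \<odot>\<^bsub>M\<^esub> \<psi> x = \<psi> (a \<odot>\<^bsub>L\<^esub> x)"
    and mult: "\<And>x y. x \<in> carrier L \<Longrightarrow> y \<in> carrier L \<Longrightarrow> \<psi> x \<otimes>\<^bsub>M\<^esub> \<psi> y = \<psi> (x \<otimes>\<^bsub>L\<^esub> y)"
  shows "lie_algebra R M" and "lie_isomorphic R M L"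
proof -
  interpret lie_algebra R L by fact
  have surj: "carrier M = \<psi> ` carrier L" using bij by (simp add: bij_betw_def)
  have ag: "abelian_group M"
  proof (rule abelian_groupI)
    fix x assume "x \<in> carrier M"
    then obtain x' where "x' \<in> carrier L" "x = \<psi> x'" unfolding surj by blast
    then show "\<exists>y\<in>carrier M. y \<oplus>\<^bsub>M\<^esub> x = \<zero>\<^bsub>M\<^esub>"
      unfolding surj
      by (intro bexI[of _ "\<psi> (\<ominus>\<^bsub>L\<^esub> x')"]) (auto simp: add zero L.M.l_neg)
  qed (auto simp: surj zero add L.M.a_ac)
  have "module R M"
    by (rule moduleI[OF R.is_cring ag])
      (auto simp: surj add smult L.smult_l_distr L.smult_r_distr L.smult_assoc1)
  moreover have "lie_algebra_axioms R M"
    by standard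
      (auto simp: surj add smult mult zero bracket_closed bracket_add_left bracket_add_right
        bracket_smult_left bracket_smult_right bracket_self jacobi)
  ultimately show "lie_algebra R M"
    by (simp add: lie_algebra_def R.field_axioms)
  let ?\<phi> = "inv_into (carrier L) \<psi>"
  have inv: "?\<phi> (\<psi> x) = x" if "x \<in> carrier L" for x
    using bij that by (simp add: bij_betw_def)
  have "?\<phi> \<in> lie_iso R M L"
    using bij_betw_inv_into[OF bij]
    by (auto simp: lie_iso_def surj add smult mult inv bracket_closed)
  then show "lie_isomorphic R M L" by (auto simp: lie_isomorphic_def)
qed

theorem theorem4:
  fixes n d :: nat and m :: "nat \<Rightarrow> real"
  assumes "n \<ge> 2" and "d \<ge> 1"
    and "\<And>i. i < n \<Longrightarrow> m i \<noteq> 0"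
    and "(\<Sum>i<n. m i) \<noteq> 0"
  shows "lie_algebra class_ring (invariant_form_algebra n d m) \<and>
    lie_isomorphic class_ring (invariant_form_algebra n d m) (sp (n - 1)) \<and>
    (\<forall>Q\<in>quadratic_forms (2 * n * d).
      Q \<in> invariant_forms n d \<longleftrightarrow>
      (\<exists>A. block_laplacian n A \<and>
        (\<forall>Z\<in>phase_space n d. Q Z = 1 / 2 * (Z \<bullet> ((A \<otimes>\<^sub>K 1\<^sub>m d) *\<^sub>v Z)))))"
proof -
  let ?H = "hamiltonian_mats (n - 1)"
  let ?\<psi> = "\<lambda>X. kronecker_form d (form_mat n m X)"
  let ?I = "invariant_form_algebra n d m"
  note [simp] = invariant_form_algebra_def sp_def
  have carrier: "form_mat n m X \<in> carrier_mat (2 * n) (2 * n)" for X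
    by (intro carrier_matI) auto
  have bl: "block_laplacian n (form_mat n m X)" if "X \<in> ?H" for X
    using that assms(4) by (rule block_laplacian_form_mat)
  then have sym: "transpose_mat (form_mat n m X) = form_mat n m X" if "X \<in> ?H" for X
    using that by (simp add: block_laplacian_def)
  have "inj_on ?\<psi> ?H"
  proof (rule inj_onI)
    fix X Y assume X: "X \<in> ?H" and Y: "Y \<in> ?H" and eq: "?\<psi> X = ?\<psi> Y"
    have "form_mat n m X = form_mat n m Y"
      using carrier sym[OF X] carrier sym[OF Y] assms(2) eq by (rule kronecker_form_inj)
    moreover have "symplectic_unit (n - 1) *
        (transpose_mat (lift_mat n m) * (form_mat n m A * lift_mat n m)) = A" if "A \<in> ?H" for A
      using assms(3) that by (rule lift_mat_form_mat)
    ultimately show "X = Y" using X Y by metis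
  qed
  moreover have "?\<psi> ` ?H = invariant_forms n d"
  proof (intro equalityI subsetI)
    fix Q assume "Q \<in> ?\<psi> ` ?H"
    then show "Q \<in> invariant_forms n d" using bl by (auto intro: kronecker_form_invariant)
  next
    fix Q assume "Q \<in> invariant_forms n d"
    then obtain A where A: "block_laplacian n A" and Q: "Q = kronecker_form d A"
      using assms(2) by (rule invariant_formsE)
    obtain X where "X \<in> ?H" "form_mat n m X = A"
      using A assms(3,4) by (rule form_mat_surj)
    then show "Q \<in> ?\<psi> ` ?H" using Q by blast
  qed
  ultimately have bij: "bij_betw ?\<psi> (carrier (sp (n - 1))) (carrier ?I)"
    by (simp add: bij_betw_def)
  have zero: "\<zero>\<^bsub>?I\<^esub> = ?\<psi> \<zero>\<^bsub>sp (n - 1)\<^esub>"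
  proof -
    have z: "0\<^sub>m (2 * (n - 1)) (2 * (n - 1)) \<in> ?H"
      using symplectic_unit_carrier[of "n - 1"] by (auto simp: hamiltonian_mats_def)
    \<comment> \<open>Homogeneity gives the image of zero: the zero matrix is 0 times
      itself.\<close>
    have "(0::real) \<cdot>\<^sub>m 0\<^sub>m (2 * (n - 1)) (2 * (n - 1)) = 0\<^sub>m (2 * (n - 1)) (2 * (n - 1))"
      by (rule eq_matI) auto
    then have "?\<psi> (0\<^sub>m (2 * (n - 1)) (2 * (n - 1))) = kronecker_form d (0 \<cdot>\<^sub>m form_mat n m (0\<^sub>m (2 * (n - 1)) (2 * (n - 1))))"
      using form_mat_smult[OF z, of m 0] by presburger
    also have "\<dots> = (\<lambda>Z\<in>phase_space n d. 0)"
      by (simp only: kronecker_form_smult[OF carrier] mult_zero_left)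
    finally have "?\<psi> (0\<^sub>m (2 * (n - 1)) (2 * (n - 1))) = (\<lambda>Z\<in>phase_space n d. 0)" .
    then show ?thesis by simp
  qed
  have add: "?\<psi> X \<oplus>\<^bsub>?I\<^esub> ?\<psi> Y = ?\<psi> (X \<oplus>\<^bsub>sp (n - 1)\<^esub> Y)" if "X \<in> ?H" "Y \<in> ?H" for X Y
    using form_mat_add[OF that] by (simp add: kronecker_form_add[OF carrier carrier])
  have smult: "c \<odot>\<^bsub>?I\<^esub> ?\<psi> X = ?\<psi> (c \<odot>\<^bsub>sp (n - 1)\<^esub> X)" if "X \<in> ?H" for c X
    using form_mat_smult[OF that] by (simp add: kronecker_form_smult[OF carrier])
  have bracket: "?\<psi> X \<otimes>\<^bsub>?I\<^esub> ?\<psi> Y = ?\<psi> (X \<otimes>\<^bsub>sp (n - 1)\<^esub> Y)" if "X \<in> ?H" "Y \<in> ?H" for X Y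
    using poisson_kronecker_form[OF carrier sym carrier sym] form_mat_bracket[of n m X Y] assms(3) that
    by simp
  have sp: "carrier (sp (n - 1)) = ?H" by simp
  have "lie_algebra class_ring ?I" "lie_isomorphic class_ring ?I (sp (n - 1))"
    by (rule lie_algebra_transport[OF sp_lie_algebra bij zero];
      rule add smult bracket; simp only: sp)+
  then show ?thesis using invariant_forms_iff[OF _ assms(2)] by blast
qed

end
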